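(* Let $\mathbb{F}$ and $\mathbb{K}$ be finite fields. Then $\mathrm{char}(\mathbb{F}) = \mathrm{char}(\mathbb{K})$ if and only if for each network $\mathcal{N}$ we have $\mathcal{C}_{lin}(\mathcal{N},\mathbb{F}) = \mathcal{C}_{lin}(\mathcal{N},\mathbb{K})$.
   Context: A network is a finite directed acyclic multigraph, some of whose nodes are sources or receivers, with finitely many message vectors (say $m$ of them), each originating at a source node; each receiver demands a specified set of the message vectors. The inputs of a node are the message vectors originating at the node together with the vectors carried by its incoming edges. For integers $k_1,\dots,k_m\ge 0$ and $n\ge 1$, a $(k_1,\dots,k_m,n)$ code over a finite alphabet $\mathcal{A}$ (with $|\mathcal{A}|\ge 2$) lets the $i$th message vector range over $\mathcal{A}^{k_i}$, assigns to each edge an edge function mapping the inputs of the edge's tail node to a vector in $\mathcal{A}^n$ (the vector carried by the edge), and assigns to each receiver and each message vector it demands a decoding function of the receiver's inputs. The code is a solution if, for all values of the message vectors, each decoding function outputs the demanded message vector. Its rate vector is $(k_1/n,\dots,k_m/n)$. For a finite field $\mathbb{F}$, a $(k_1,\dots,k_m,n)$ code over the alphabet $\mathbb{F}$ is linear if every edge function and decoding function is of the form $\mathbf{x}\mapsto A\mathbf{x}$, where $\mathbf{x}$ is the concatenation of the input vectors of the node and $A$ is a matrix over $\mathbb{F}$. A rate vector $\mathbf{r}$ is linearly achievable for $\mathcal{N}$ over $\mathbb{F}$ if $\mathcal{N}$ has a linear solution over $\mathbb{F}$ (for some block sizes $k_1,\dots,k_m,n$) with rate vector $\mathbf{r}$.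 The linear capacity is $\mathcal{C}_{lin}(\mathcal{N},\mathbb{F})=\sup\{r\in\mathbb{Q} : (r,\dots,r)\text{ is linearly achievable for }\mathcal{N}\text{ over }\mathbb{F}\}$ (a supremum in the extended reals). *)

theory Defs
  imports
    "HOL-Library.Extended_Real"
    "HOL-Computational_Algebra.Primes"
    "Graph_Theory.Digraph"
    "Jordan_Normal_Form.Matrix"
begin

section \<open>Networks\<close>

text \<open>
  Nodes and edges are named by natural numbers; as networks are finite, every network has such a
  naming. The messages are \<open>0, \<dots>, num_msgs N - 1\<close>.
\<close>

record net =
  net_graph :: "(nat, nat) pre_digraph"
  sources :: "nat set"
  receivers :: "nat set"
  num_msgs :: nat
  origin :: "nat \<Rightarrow> nat"
  demands :: "nat \<Rightarrow> nat set"

locale network = fin_digraph "net_graph N" for N :: net +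
  assumes acyclic: "acyclic (arcs_ends (net_graph N))"
    and sources: "sources N \<subseteq> verts (net_graph N)"
    and receivers: "receivers N \<subseteq> verts (net_graph N)"
    and origin: "i < num_msgs N \<Longrightarrow> origin N i \<in> sources N"
    and demands: "v \<in> receivers N \<Longrightarrow> demands N v \<subseteq> {..<num_msgs N}"

definition msgs_at :: "net \<Rightarrow> nat \<Rightarrow> nat list" where
  "msgs_at N v = sorted_list_of_set {i. i < num_msgs N \<and> origin N i = v}"

definition edges_into :: "net \<Rightarrow> nat \<Rightarrow> nat list" where
  "edges_into N v = sorted_list_of_set (in_arcs (net_graph N) v)"


section \<open>Codes\<close>

text \<open>
  The alphabet is the type \<open>'a\<close>. Message \<open>i\<close> has \<open>msg_dim C i\<close> components (the number $k_{i+1}$)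
  and every edge carries \<open>edge_dim C\<close> components (the number $n$). Edge and decoding functions take
  the list of the inputs of a node; \<open>dec_fun C v i\<close> is used by receiver \<open>v\<close> for message \<open>i\<close>.
\<close>

record 'a code =
  msg_dim :: "nat \<Rightarrow> nat"
  edge_dim :: nat
  edge_fun :: "nat \<Rightarrow> 'a vec list \<Rightarrow> 'a vec"
  dec_fun :: "nat \<Rightarrow> nat \<Rightarrow> 'a vec list \<Rightarrow> 'a vec"

definition input_dims :: "net \<Rightarrow> 'a code \<Rightarrow> nat \<Rightarrow> nat list" where
  "input_dims N C v = map (msg_dim C) (msgs_at N v) @ map (\<lambda>_. edge_dim C) (edges_into N v)"

definition input_space :: "net \<Rightarrow> 'a code \<Rightarrow> nat \<Rightarrow> 'a vec list set" where
  "input_space N C v = listset (map carrier_vec (input_dims N C v))"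

definition is_code :: "net \<Rightarrow> 'a code \<Rightarrow> bool" where
  "is_code N C \<longleftrightarrow>
     finite (UNIV :: 'a set) \<and> 2 \<le> card (UNIV :: 'a set) \<and> 1 \<le> edge_dim C \<and>
     (\<forall>e \<in> arcs (net_graph N).
        edge_fun C e \<in> input_space N C (tail (net_graph N) e) \<rightarrow> carrier_vec (edge_dim C)) \<and>
     (\<forall>v \<in> receivers N. \<forall>i \<in> demands N v.
        dec_fun C v i \<in> input_space N C v \<rightarrow> carrier_vec (msg_dim C i))"

definition inputs :: "net \<Rightarrow> (nat \<Rightarrow> 'a vec) \<Rightarrow> (nat \<Rightarrow> 'a vec) \<Rightarrow> nat \<Rightarrow> 'a vec list" where
  "inputs N x y v = map x (msgs_at N v) @ map y (edges_into N v)"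

text \<open>
  \<open>carries N C x y\<close>: for the message values \<open>x\<close>, each edge \<open>e\<close> carries the vector \<open>y e\<close>. In a
  network such a \<open>y\<close> exists and is unique on the edges; see \<open>carries_exists\<close> and
  \<open>carries_unique\<close> below.
\<close>

definition carries :: "net \<Rightarrow> 'a code \<Rightarrow> (nat \<Rightarrow> 'a vec) \<Rightarrow> (nat \<Rightarrow> 'a vec) \<Rightarrow> bool" where
  "carries N C x y \<longleftrightarrow>
     (\<forall>e \<in> arcs (net_graph N). y e = edge_fun C e (inputs N x y (tail (net_graph N) e)))"

definition is_solution :: "net \<Rightarrow> 'a code \<Rightarrow> bool" where
  "is_solution N C \<longleftrightarrow> is_code N C \<and>
     (\<forall>x y. (\<forall>i < num_msgs N. x i \<in> carrier_vec (msg_dim C i)) \<longrightarrow> carries N C x y \<longrightarrow>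
        (\<forall>v \<in> receivers N. \<forall>i \<in> demands N v. dec_fun C v i (inputs N x y v) = x i))"

definition rate_vector :: "net \<Rightarrow> 'a code \<Rightarrow> rat vec" where
  "rate_vector N C = vec (num_msgs N) (\<lambda>i. of_nat (msg_dim C i) / of_nat (edge_dim C))"


section \<open>Linear codes and linear capacity\<close>

definition concat_vecs :: "'a :: zero vec list \<Rightarrow> 'a vec" where
  "concat_vecs xs = foldr append_vec xs vNil"

definition linear_on :: "'a :: semiring_0 vec list set \<Rightarrow> nat \<Rightarrow> nat \<Rightarrow> ('a vec list \<Rightarrow> 'a vec) \<Rightarrow> bool"
  where "linear_on X r c f \<longleftrightarrow> (\<exists>A \<in> carrier_mat r c. \<forall>xs \<in> X. f xs = A *\<^sub>v concat_vecs xs)"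

definition is_linear :: "net \<Rightarrow> 'a :: finite_field code \<Rightarrow> bool" where
  "is_linear N C \<longleftrightarrow>
     (\<forall>e \<in> arcs (net_graph N). let v = tail (net_graph N) e in
        linear_on (input_space N C v) (edge_dim C) (sum_list (input_dims N C v)) (edge_fun C e)) \<and>
     (\<forall>v \<in> receivers N. \<forall>i \<in> demands N v.
        linear_on (input_space N C v) (msg_dim C i) (sum_list (input_dims N C v)) (dec_fun C v i))"

definition linearly_achievable :: "'f :: finite_field itself \<Rightarrow> net \<Rightarrow> rat vec \<Rightarrow> bool" where
  "linearly_achievable _ N r \<longleftrightarrow>
     (\<exists>C :: 'f code. is_solution N C \<and> is_linear N C \<and> rate_vector N C = r)"

definition linear_capacity :: "'f :: finite_field itself \<Rightarrow> net \<Rightarrow> ereal" where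
  "linear_capacity F N =
     Sup {ereal (of_rat r) | r. linearly_achievable F N (vec (num_msgs N) (\<lambda>_. r))}"


section \<open>The vectors carried by the edges are well defined\<close>

context network
begin

definition edge_order :: "(nat \<times> nat) set" where
  "edge_order = {(d, e). d \<in> arcs (net_graph N) \<and> e \<in> arcs (net_graph N) \<and>
     head (net_graph N) d = tail (net_graph N) e}"

lemma wf_edge_order: "wf edge_order"
proof -
  have fin: "finite (arcs_ends (net_graph N))"
    by (simp add: arcs_ends_def)
  have "wf (inv_image (arcs_ends (net_graph N)) (tail (net_graph N)))"
    by (intro wf_inv_image finite_acyclic_wf fin acyclic)
  moreover have "edge_order \<subseteq> inv_image (arcs_ends (net_graph N)) (tail (net_graph N))"
    by (force simp: edge_order_def inv_image_def arcs_ends_conv)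
  ultimately show ?thesis
    by (rule wf_subset)
qed

lemma set_edges_into:
  "set (edges_into N v) = {d \<in> arcs (net_graph N). head (net_graph N) d = v}"
  by (simp add: edges_into_def in_arcs_def)

lemma inputs_cong:
  assumes "e \<in> arcs (net_graph N)" "\<And>d. (d, e) \<in> edge_order \<Longrightarrow> y d = y' d"
  shows "inputs N x y (tail (net_graph N) e) = inputs N x y' (tail (net_graph N) e)"
  using assms by (auto simp: inputs_def set_edges_into edge_order_def)

lemma carries_exists: "\<exists>y. carries N C x y"
proof -
  define H where "H y e = edge_fun C e (inputs N x y (tail (net_graph N) e))" for y e
  define y where "y = wfrec edge_order H"
  have "y e = H y e" if "e \<in> arcs (net_graph N)" for e
  proof -
    have "y e = H (cut y edge_order e) e"
      unfolding y_def by (rule wfrec[OF wf_edge_order])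
    also have "\<dots> = H y e"
      unfolding H_def using inputs_cong[OF that, of "cut y edge_order e" y x]
      by (simp add: cut_apply)
    finally show ?thesis .
  qed
  then show ?thesis
    by (auto simp: carries_def H_def)
qed

lemma carries_unique:
  assumes "carries N C x y" "carries N C x y'" "e \<in> arcs (net_graph N)"
  shows "y e = y' e"
  using wf_edge_order assms(3)
proof (induction e rule: wf_induct_rule)
  case (less e)
  have "inputs N x y (tail (net_graph N) e) = inputs N x y' (tail (net_graph N) e)"
    by (rule inputs_cong[OF less.prems]) (use less.IH in \<open>auto simp: edge_order_def\<close>)
  with assms(1,2) less.prems show ?case
    by (simp add: carries_def)
qed

end

end

theory Submission
  imports Defs
begin

text \<open>
  In equal characteristic, a linear code over \<open>'f\<close> becomes one over \<open>'k\<close> with the same rates when each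
  matrix entry is replaced by the matrix, over the prime field, of the multiplication by it. The
  \<open>'f\<close>-linear maps from \<open>'k\<^sup>d\<close> to \<open>'f\<close> separate points and turn every run of the new code into a run of
  the old one, so the new code is again a solution.

  In different characteristics, let \<open>p\<close> be the characteristic of \<open>'f\<close> and take \<open>M = p + 1\<close> messages. Let
  one bottleneck carry \<open>e\<close>, a function of all the messages, and for each \<open>i\<close> let another one carry
  \<open>e\<^sub>i\<close>, a function of all the messages but \<open>i\<close>; demand that message \<open>i\<close> be determined by \<open>e\<close> and
  \<open>e\<^sub>i\<close>, and all the messages by the \<open>e\<^sub>i\<close>. Scalar sums achieve rate 1 whenever \<open>p\<close> is invertible.
  Over \<open>'f\<close>, the sum of the almost complete sums of the messages vanishes, a linear dependency
  which costs a fixed fraction of the rate.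
\<close>

section \<open>Concatenated inputs\<close>

lemma in_listset_carrier_vec: "xs \<in> listset (map carrier_vec ds) \<longleftrightarrow> map dim_vec xs = ds"
proof (induction ds arbitrary: xs)
  case Nil
  then show ?case by simp
next
  case (Cons d ds)
  then show ?case by (cases xs) (auto simp: set_Cons_def)
qed

lemma in_input_space_iff: "xs \<in> input_space N C v \<longleftrightarrow> map dim_vec xs = input_dims N C v"
  by (simp add: input_space_def in_listset_carrier_vec)

lemma concat_vecs_Nil: "concat_vecs [] = vNil"
  by (simp add: concat_vecs_def)

lemma concat_vecs_Cons: "concat_vecs (x # xs) = x @\<^sub>v concat_vecs xs"
  by (simp add: concat_vecs_def)

lemma dim_concat_vecs: "dim_vec (concat_vecs xs) = sum_list (map dim_vec xs)"
  by (induction xs) (auto simp: concat_vecs_Nil concat_vecs_Cons)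

lemma concat_vecs_append: "concat_vecs (xs @ ys) = concat_vecs xs @\<^sub>v concat_vecs ys"
proof (induction xs)
  case Nil
  then show ?case by (simp add: concat_vecs_Nil)
next
  case (Cons x xs)
  then show ?case by (auto simp: concat_vecs_Cons intro!: eq_vecI)
qed

lemma concat_vecs_map_add:
  fixes f g :: "'b \<Rightarrow> 'a :: monoid_add vec"
  assumes "\<And>a. a \<in> set as \<Longrightarrow> dim_vec (f a) = dim_vec (g a)"
  shows "concat_vecs (map (\<lambda>a. f a + g a) as) = concat_vecs (map f as) + concat_vecs (map g as)"
  using assms
proof (induction as)
  case Nil
  then show ?case by (auto simp: concat_vecs_Nil)
next
  case (Cons a as)
  have dims: "sum_list (map (dim_vec \<circ> f) as) = sum_list (map (dim_vec \<circ> g) as)"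
    using Cons.prems by (intro arg_cong[where f = sum_list] map_cong) auto
  have *: "(f a + g a) @\<^sub>v (concat_vecs (map f as) + concat_vecs (map g as)) =
      (f a @\<^sub>v concat_vecs (map f as)) + (g a @\<^sub>v concat_vecs (map g as))"
    by (rule append_vec_add[symmetric, of _ "dim_vec (g a)" _ _ "dim_vec (concat_vecs (map g as))"])
      (rule carrier_vecI; simp add: dim_concat_vecs Cons.prems dims)+
  have IH: "concat_vecs (map (\<lambda>a. f a + g a) as) = concat_vecs (map f as) + concat_vecs (map g as)"
    using Cons by simp
  show ?case
    by (simp only: list.map concat_vecs_Cons IH *)
qed

lemma concat_vecs_zero:
  assumes "\<And>x. x \<in> set xs \<Longrightarrow> x = 0\<^sub>v (dim_vec x)"
  shows "concat_vecs xs = 0\<^sub>v (sum_list (map dim_vec xs))"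
  using assms
proof (induction xs)
  case Nil
  then show ?case by (auto simp: concat_vecs_Nil)
next
  case (Cons x xs)
  then obtain m where "x = 0\<^sub>v m" by auto
  then show ?case
    using Cons by (auto simp: concat_vecs_Cons)
qed


section \<open>Linear solutions\<close>

locale linear_solution = network N for N :: net +
  fixes C :: "'f :: finite_field code"
  assumes solution: "is_solution N C" and linear: "is_linear N C"
begin

abbreviation messages :: "(nat \<Rightarrow> 'f vec) \<Rightarrow> bool" where
  "messages x \<equiv> \<forall>i < num_msgs N. x i \<in> carrier_vec (msg_dim C i)"

lemma set_msgs_at: "set (msgs_at N v) = {i. i < num_msgs N \<and> origin N i = v}"
  by (simp add: msgs_at_def)

lemma inputs_in_input_space:
  assumes "messages x" "\<And>d. d \<in> set (edges_into N v) \<Longrightarrow> y d \<in> carrier_vec (edge_dim C)"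
  shows "inputs N x y v \<in> input_space N C v"
  using assms by (auto simp: in_input_space_iff inputs_def input_dims_def set_msgs_at)

text \<open>\<open>carries\<close> itself imposes no dimensions. They propagate along the
  well-founded order of the edges, since the edge functions of a code map well-dimensioned inputs to
  \<open>n\<close>-vectors.\<close>

lemma carries_in_carrier:
  assumes "messages x" "carries N C x y" "e \<in> arcs (net_graph N)"
  shows "y e \<in> carrier_vec (edge_dim C)"
  using wf_edge_order assms(3)
proof (induction e rule: wf_induct_rule)
  case (less e)
  have "inputs N x y (tail (net_graph N) e) \<in> input_space N C (tail (net_graph N) e)"
    by (rule inputs_in_input_space[OF assms(1)])
      (use less in \<open>auto simp: set_edges_into edge_order_def\<close>)
  with less.prems assms(2) solution show ?case
    by (auto simp: carries_def is_solution_def is_code_def Pi_iff)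
qed

lemma carries_in_input_space:
  assumes "messages x" "carries N C x y"
  shows "inputs N x y v \<in> input_space N C v"
  by (rule inputs_in_input_space[OF assms(1)])
    (use carries_in_carrier[OF assms] in \<open>auto simp: set_edges_into\<close>)

lemma edge_matrix:
  assumes "e \<in> arcs (net_graph N)"
  obtains A where "A \<in> carrier_mat (edge_dim C) (sum_list (input_dims N C (tail (net_graph N) e)))"
    "\<And>xs. xs \<in> input_space N C (tail (net_graph N) e) \<Longrightarrow> edge_fun C e xs = A *\<^sub>v concat_vecs xs"
  using linear assms unfolding is_linear_def linear_on_def Let_def by metis

lemma decoding_matrix:
  assumes "v \<in> receivers N" "i \<in> demands N v"
  obtains B where "B \<in> carrier_mat (msg_dim C i) (sum_list (input_dims N C v))"
    "\<And>xs. xs \<in> input_space N C v \<Longrightarrow> dec_fun C v i xs = B *\<^sub>v concat_vecs xs"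
  using linear assms unfolding is_linear_def linear_on_def by metis

section \<open>Superposition of runs\<close>

lemma dim_concat_inputs:
  assumes "messages x" "carries N C x y"
  shows "concat_vecs (inputs N x y v) \<in> carrier_vec (sum_list (input_dims N C v))"
  by (rule carrier_vecI)
    (use carries_in_input_space[OF assms, of v] in \<open>simp add: in_input_space_iff dim_concat_vecs\<close>)

lemma concat_inputs_add:
  assumes "messages x" "carries N C x y" "messages x'" "carries N C x' y'"
  shows "concat_vecs (inputs N (\<lambda>i. x i + x' i) (\<lambda>e. y e + y' e) v) =
    concat_vecs (inputs N x y v) + concat_vecs (inputs N x' y' v)"
proof -
  have m: "dim_vec (x i) = dim_vec (x' i)" if "i \<in> set (msgs_at N v)" for i
    using that assms(1,3) by (auto simp: set_msgs_at)
  have e: "dim_vec (y d) = dim_vec (y' d)" if "d \<in> set (edges_into N v)" for d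
    using that carries_in_carrier[OF assms(1,2), of d] carries_in_carrier[OF assms(3,4), of d]
    by (simp add: set_edges_into carrier_vecD)
  have dm: "sum_list (map (dim_vec \<circ> x) (msgs_at N v)) = sum_list (map (dim_vec \<circ> x') (msgs_at N v))"
    using m by (intro arg_cong[where f = sum_list] map_cong) auto
  have de: "sum_list (map (dim_vec \<circ> y) (edges_into N v)) = sum_list (map (dim_vec \<circ> y') (edges_into N v))"
    using e by (intro arg_cong[where f = sum_list] map_cong) auto
  have "concat_vecs (map (\<lambda>i. x i + x' i) (msgs_at N v)) =
      concat_vecs (map x (msgs_at N v)) + concat_vecs (map x' (msgs_at N v))"
    by (rule concat_vecs_map_add) (rule m)
  moreover have "concat_vecs (map (\<lambda>d. y d + y' d) (edges_into N v)) =
      concat_vecs (map y (edges_into N v)) + concat_vecs (map y' (edges_into N v))"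
    by (rule concat_vecs_map_add) (rule e)
  ultimately show ?thesis
    unfolding inputs_def concat_vecs_append
    by (simp only:) (rule append_vec_add[symmetric]; rule carrier_vecI;
      simp add: dim_concat_vecs dm de)
qed

text \<open>Edge functions act as matrices and hence respect sums. Dimensions match because every
  run stays in the carriers.\<close>

lemma carries_add:
  assumes "messages x" "carries N C x y" "messages x'" "carries N C x' y'"
  shows "carries N C (\<lambda>i. x i + x' i) (\<lambda>e. y e + y' e)"
  unfolding carries_def
proof
  fix e assume e: "e \<in> arcs (net_graph N)"
  let ?v = "tail (net_graph N) e"
  obtain A where A: "A \<in> carrier_mat (edge_dim C) (sum_list (input_dims N C ?v))"
    "\<And>xs. xs \<in> input_space N C ?v \<Longrightarrow> edge_fun C e xs = A *\<^sub>v concat_vecs xs"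
    using edge_matrix[OF e] by metis
  have "inputs N (\<lambda>i. x i + x' i) (\<lambda>e. y e + y' e) ?v \<in> input_space N C ?v"
    by (rule inputs_in_input_space)
      (use assms carries_in_carrier[OF assms(1,2)] carries_in_carrier[OF assms(3,4)]
        in \<open>auto simp: set_edges_into\<close>)
  then have "edge_fun C e (inputs N (\<lambda>i. x i + x' i) (\<lambda>e. y e + y' e) ?v) =
      A *\<^sub>v concat_vecs (inputs N x y ?v) + A *\<^sub>v concat_vecs (inputs N x' y' ?v)"
    using A dim_concat_inputs[OF assms(1,2)] dim_concat_inputs[OF assms(3,4)]
    by (simp add: concat_inputs_add[OF assms] mult_add_distrib_mat_vec)
  also have "\<dots> = edge_fun C e (inputs N x y ?v) + edge_fun C e (inputs N x' y' ?v)"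
    using A(2) assms by (simp add: carries_in_input_space)
  also have "\<dots> = y e + y' e"
    using assms e by (simp add: carries_def)
  finally show "y e + y' e = edge_fun C e (inputs N (\<lambda>i. x i + x' i) (\<lambda>e. y e + y' e) ?v)" ..
qed

section \<open>Nodes whose inputs all vanish\<close>

lemma concat_inputs_zero:
  assumes "messages x" "carries N C x y"
    and "\<And>i. i \<in> set (msgs_at N v) \<Longrightarrow> x i = 0\<^sub>v (msg_dim C i)"
    and "\<And>d. d \<in> set (edges_into N v) \<Longrightarrow> y d = 0\<^sub>v (edge_dim C)"
  shows "concat_vecs (inputs N x y v) = 0\<^sub>v (sum_list (input_dims N C v))"
proof -
  have "concat_vecs (inputs N x y v) = 0\<^sub>v (sum_list (map dim_vec (inputs N x y v)))"
    by (rule concat_vecs_zero) (use assms in \<open>auto simp: inputs_def\<close>)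
  then show ?thesis
    using carries_in_input_space[OF assms(1,2), of v] by (simp add: in_input_space_iff)
qed

text \<open>A matrix has no constant term. This is how invisibility of a message tuple spreads along
  arcs.\<close>

lemma edge_zero:
  assumes "messages x" "carries N C x y" "e \<in> arcs (net_graph N)"
    and "\<And>i. i \<in> set (msgs_at N (tail (net_graph N) e)) \<Longrightarrow> x i = 0\<^sub>v (msg_dim C i)"
    and "\<And>d. d \<in> set (edges_into N (tail (net_graph N) e)) \<Longrightarrow> y d = 0\<^sub>v (edge_dim C)"
  shows "y e = 0\<^sub>v (edge_dim C)"
proof -
  let ?v = "tail (net_graph N) e"
  obtain A where A: "A \<in> carrier_mat (edge_dim C) (sum_list (input_dims N C ?v))"
    "\<And>xs. xs \<in> input_space N C ?v \<Longrightarrow> edge_fun C e xs = A *\<^sub>v concat_vecs xs"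
    using edge_matrix[OF assms(3)] by metis
  have "y e = edge_fun C e (inputs N x y ?v)"
    using assms by (simp add: carries_def)
  also have "\<dots> = A *\<^sub>v 0\<^sub>v (sum_list (input_dims N C ?v))"
    using A(2) concat_inputs_zero[OF assms(1,2,4,5)] carries_in_input_space[OF assms(1,2)] by simp
  finally show ?thesis
    using A(1) by (auto intro!: eq_vecI simp: scalar_prod_def)
qed

text \<open>The decoder returns the demanded message and, being linear, returns zero on zero inputs.
  So whatever a receiver cannot see must vanish.\<close>

lemma demanded_zero:
  assumes "messages x" "carries N C x y" "v \<in> receivers N" "i \<in> demands N v"
    and "\<And>i. i \<in> set (msgs_at N v) \<Longrightarrow> x i = 0\<^sub>v (msg_dim C i)"
    and "\<And>d. d \<in> set (edges_into N v) \<Longrightarrow> y d = 0\<^sub>v (edge_dim C)"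
  shows "x i = 0\<^sub>v (msg_dim C i)"
proof -
  obtain B where B: "B \<in> carrier_mat (msg_dim C i) (sum_list (input_dims N C v))"
    "\<And>xs. xs \<in> input_space N C v \<Longrightarrow> dec_fun C v i xs = B *\<^sub>v concat_vecs xs"
    using decoding_matrix[OF assms(3,4)] by metis
  have "x i = dec_fun C v i (inputs N x y v)"
    using assms(1-4) solution unfolding is_solution_def by metis
  also have "\<dots> = B *\<^sub>v 0\<^sub>v (sum_list (input_dims N C v))"
    using B(2) concat_inputs_zero[OF assms(1,2,5,6)] carries_in_input_space[OF assms(1,2)] by simp
  finally show ?thesis
    using B(1) by (auto intro!: eq_vecI simp: scalar_prod_def)
qed

section \<open>Runs parametrised by arrays of scalars\<close>

definition msg_vecs :: "(nat \<Rightarrow> nat \<Rightarrow> 'f) \<Rightarrow> nat \<Rightarrow> 'f vec" where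
  "msg_vecs u i = vec (msg_dim C i) (u i)"

text \<open>The messages determine a run only on the arcs, so one whole function \<open>y\<close> is
  fixed by choice.\<close>

definition edge_vecs :: "(nat \<Rightarrow> nat \<Rightarrow> 'f) \<Rightarrow> nat \<Rightarrow> 'f vec" where
  "edge_vecs u = (SOME y. carries N C (msg_vecs u) y)"

lemma messages_msg_vecs: "messages (msg_vecs u)"
  by (simp add: msg_vecs_def)

lemma carries_edge_vecs: "carries N C (msg_vecs u) (edge_vecs u)"
  unfolding edge_vecs_def using carries_exists by (rule someI_ex)

lemma edge_vecs_add:
  assumes "e \<in> arcs (net_graph N)"
  shows "edge_vecs (\<lambda>j c. u j c + v j c) e = edge_vecs u e + edge_vecs v e"
proof -
  have "msg_vecs (\<lambda>j c. u j c + v j c) = (\<lambda>i. msg_vecs u i + msg_vecs v i)"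
    by (intro ext) (auto simp: msg_vecs_def)
  then show ?thesis
    using carries_unique[OF carries_edge_vecs _ assms, of "\<lambda>j c. u j c + v j c"]
      carries_add[OF messages_msg_vecs carries_edge_vecs messages_msg_vecs carries_edge_vecs, of u v]
    by simp
qed

lemma edge_vecs_in_carrier:
  "e \<in> arcs (net_graph N) \<Longrightarrow> edge_vecs u e \<in> carrier_vec (edge_dim C)"
  by (rule carries_in_carrier[OF messages_msg_vecs carries_edge_vecs])

end


section \<open>Coordinates over the prime field\<close>

text \<open>Bezout with the prime characteristic. Elements of the prime field are handled as images
  of integers, and the inverse of a nonzero one is again of this form.\<close>

lemma exists_integer_inverse:
  assumes "of_int z \<noteq> (0 :: 'a :: finite_field)"
  obtains r where "of_int r * of_int z = (1 :: 'a)"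
proof -
  have "prime (int CHAR('a))" by simp
  then have "coprime z (int CHAR('a))"
    using assms by (metis coprime_commute of_int_eq_0_iff_char_dvd prime_imp_coprime)
  then obtain r s where "r * z + s * int CHAR('a) = 1"
    using bezout_int[of z "int CHAR('a)"] by auto
  then have "of_int (r * z + s * int CHAR('a)) = (1 :: 'a)" by simp
  then show thesis
    by (intro that[of r]) simp
qed

definition spanning :: "'a :: ring_1 set \<Rightarrow> bool" where
  "spanning B \<longleftrightarrow> (\<forall>x. \<exists>m. x = (\<Sum>b\<in>B. of_int (m b) * b))"

text \<open>The coefficient of \<open>b\<close> has an integer inverse, so the relation expresses
  \<open>b\<close> by the other elements.\<close>

lemma spanning_remove:
  fixes B :: "'a :: finite_field set"
  assumes "spanning B" "b \<in> B" "(\<Sum>b\<in>B. of_int (m b) * b) = 0" "of_int (m b) \<noteq> (0 :: 'a)"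
  shows "spanning (B - {b})"
proof -
  obtain r where r: "of_int r * of_int (m b) = (1 :: 'a)"
    using assms(4) by (rule exists_integer_inverse)
  have fin: "finite B" by simp
  have "of_int (m b) * b = - (\<Sum>b\<in>B - {b}. of_int (m b) * b)"
    using assms(3) sum.remove[OF fin assms(2), of "\<lambda>b. of_int (m b) * b"]
    by (simp add: eq_neg_iff_add_eq_0)
  then have b: "b = of_int r * - (\<Sum>b\<in>B - {b}. of_int (m b) * b)"
    using r by (metis mult.assoc mult_1)
  show ?thesis
    unfolding spanning_def
  proof
    fix x :: 'a
    obtain l where "x = (\<Sum>b\<in>B. of_int (l b) * b)"
      using assms(1) unfolding spanning_def by blast
    then have "x = of_int (l b) * b + (\<Sum>b\<in>B - {b}. of_int (l b) * b)"
      using sum.remove[OF fin assms(2)] by metis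
    also have "of_int (l b) * b = (\<Sum>c\<in>B - {b}. of_int (- l b * r * m c) * c)"
      by (subst b) (simp add: sum_distrib_left sum_negf mult.assoc)
    finally have "x = (\<Sum>c\<in>B - {b}. of_int (l c - l b * r * m c) * c)"
      by (simp add: algebra_simps flip: sum.distrib)
    then show "\<exists>m. x = (\<Sum>b\<in>B - {b}. of_int (m b) * b)"
      by (intro exI[of _ "\<lambda>c. l c - l b * r * m c"])
  qed
qed

text \<open>A spanning set of least cardinality is a basis: a relation with a nonzero coefficient
  would allow a removal. Integer coordinates are determined only modulo the characteristic, hence
  independence speaks of their images in the field.\<close>

lemma exists_prime_field_coordinates:
  obtains d b and co :: "'a :: finite_field \<Rightarrow> nat \<Rightarrow> int" where "0 < d"
    "\<And>x. x = (\<Sum>t<d. of_int (co x t) * b t)"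
    "\<And>m t. (\<Sum>t<d. of_int (m t) * b t) = 0 \<Longrightarrow> t < d \<Longrightarrow> of_int (m t) = (0 :: 'a)"
proof -
  have "spanning (UNIV :: 'a set)"
    unfolding spanning_def
  proof
    fix x :: 'a
    have "(\<Sum>b\<in>UNIV. of_int (if b = x then 1 else 0) * b) = (\<Sum>b\<in>UNIV. if b = x then b else 0)"
      by (intro sum.cong) auto
    also have "\<dots> = x"
      by (simp add: sum.delta')
    finally show "\<exists>m. x = (\<Sum>b\<in>UNIV. of_int (m b) * b)"
      by (intro exI[of _ "\<lambda>b. if b = x then 1 else 0"]) simp
  qed
  then obtain B :: "'a set" where B: "spanning B" "\<And>B' :: 'a set. spanning B' \<Longrightarrow> card B \<le> card B'"
    using ex_has_least_nat[of spanning "UNIV :: 'a set" card] by auto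
  obtain b where b: "bij_betw b {0..<card B} B"
    using ex_bij_betw_nat_finite[of B] by auto
  have reindex: "(\<Sum>t<card B. of_int (m (b t)) * b t) = (\<Sum>c\<in>B. of_int (m c) * c)" for m
    using sum.reindex_bij_betw[OF b] by (simp add: lessThan_atLeast0)
  obtain l where l: "x = (\<Sum>c\<in>B. of_int (l x c) * c)" for x :: 'a
    using B(1) unfolding spanning_def by metis
  show thesis
  proof (rule that)
    show "0 < card B"
    proof (rule ccontr)
      assume "\<not> 0 < card B"
      then have "B = {}" by simp
      then show False
        using l[of 1] by simp
    qed
    show "x = (\<Sum>t<card B. of_int (l x (b t)) * b t)" for x
      using reindex[of "l x"] l[of x] by simp
  next
    fix m t assume m: "(\<Sum>t<card B. of_int (m t) * b t) = 0" and t: "t < card B"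
    \<comment> \<open>\<open>m'\<close> moves the coefficients from positions to elements of
      \<open>B\<close>, as \<open>spanning_remove\<close> expects.\<close>
    define m' where "m' = m \<circ> the_inv_into {0..<card B} b"
    have m': "m' (b s) = m s" if "s < card B" for s
      using the_inv_into_f_f[OF bij_betw_imp_inj_on[OF b], of s] that by (simp add: m'_def)
    have sum_m': "(\<Sum>c\<in>B. of_int (m' c) * c) = 0"
      using m by (simp add: m' flip: reindex)
    have bt: "b t \<in> B"
      using b t by (auto simp: bij_betw_def)
    have "spanning (B - {b t})" if "of_int (m' (b t)) \<noteq> (0 :: 'a)"
      by (rule spanning_remove[OF B(1) bt sum_m' that])
    moreover have "\<not> spanning (B - {b t})"
      using B(2)[of "B - {b t}"] card_Diff1_less[OF _ bt] by auto
    ultimately show "of_int (m t) = (0 :: 'a)"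
      using m'[OF t] by (cases "of_int (m t) = (0 :: 'a)") auto
  qed
qed

text \<open>The functionals are the coordinates for a basis of \<open>'k\<close>, with their
  integers read in \<open>'f\<close>. Integer coordinates are linear only modulo the characteristic;
  this survives the change of field because the same integers vanish in both fields.\<close>

lemma exists_prime_field_functionals:
  assumes "CHAR('f :: finite_field) = CHAR('k :: finite_field)"
  obtains T :: "('k :: finite_field \<Rightarrow> 'f :: finite_field) set" where
    "\<And>\<tau> x y. \<tau> \<in> T \<Longrightarrow> \<tau> (x + y) = \<tau> x + \<tau> y"
    "\<And>\<tau> z x. \<tau> \<in> T \<Longrightarrow> \<tau> (of_int z * x) = of_int z * \<tau> x"
    "\<And>\<tau> x. \<tau> \<in> T \<Longrightarrow> \<tau> x \<in> \<int>"
    "\<And>x. (\<And>\<tau>. \<tau> \<in> T \<Longrightarrow> \<tau> x = 0) \<Longrightarrow> x = 0"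
proof -
  obtain d b and co :: "'k \<Rightarrow> nat \<Rightarrow> int" where
    co: "\<And>x. x = (\<Sum>t<d. of_int (co x t) * b t)" and
    indep: "\<And>m t. (\<Sum>t<d. of_int (m t) * b t) = 0 \<Longrightarrow> t < d \<Longrightarrow> of_int (m t) = (0 :: 'k)"
    using exists_prime_field_coordinates by metis
  have char: "of_int z = (0 :: 'f) \<longleftrightarrow> of_int z = (0 :: 'k)" for z
    using assms by (simp add: of_int_eq_0_iff_char_dvd)
  have add: "(of_int (co (x + y) t) :: 'f) = of_int (co x t) + of_int (co y t)" if "t < d" for x y t
  proof -
    have "(\<Sum>t<d. of_int (co (x + y) t - co x t - co y t) * b t) =
        (\<Sum>t<d. of_int (co (x + y) t) * b t) - (\<Sum>t<d. of_int (co x t) * b t) -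
        (\<Sum>t<d. of_int (co y t) * b t)"
      by (simp add: left_diff_distrib sum_subtractf)
    also have "\<dots> = 0"
      by (simp flip: co)
    finally have "of_int (co (x + y) t - co x t - co y t) = (0 :: 'k)"
      using that by (rule indep)
    then have "of_int (co (x + y) t - co x t - co y t) = (0 :: 'f)"
      by (simp only: char)
    then show ?thesis
      by (simp add: algebra_simps)
  qed
  have scale: "(of_int (co (of_int z * x) t) :: 'f) = of_int z * of_int (co x t)" if "t < d" for x z t
  proof -
    have "(\<Sum>t<d. of_int (co (of_int z * x) t - z * co x t) * b t) =
        (\<Sum>t<d. of_int (co (of_int z * x) t) * b t) - of_int z * (\<Sum>t<d. of_int (co x t) * b t)"
      by (simp add: left_diff_distrib sum_subtractf sum_distrib_left mult.assoc)
    also have "\<dots> = 0"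
      by (simp flip: co)
    finally have "of_int (co (of_int z * x) t - z * co x t) = (0 :: 'k)"
      using that by (rule indep)
    then have "of_int (co (of_int z * x) t - z * co x t) = (0 :: 'f)"
      by (simp only: char)
    then show ?thesis
      by simp
  qed
  show thesis
  proof (rule that[of "(\<lambda>t x. of_int (co x t)) ` {..<d}"])
    fix x assume x: "\<And>\<tau>. \<tau> \<in> (\<lambda>t x. of_int (co x t) :: 'f) ` {..<d} \<Longrightarrow> \<tau> x = 0"
    have "(of_int (co x t) :: 'k) = 0" if "t < d" for t
      using x[of "\<lambda>x. of_int (co x t)"] that char by auto
    then have "(\<Sum>t<d. of_int (co x t) * b t) = 0"
      by simp
    then show "x = 0"
      by (simp flip: co)
  qed (auto simp: add scale)
qed


section \<open>Equal characteristic\<close>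

lemma sum_lessThan_mult:
  fixes g :: "nat \<Rightarrow> 'a :: comm_monoid_add"
  shows "(\<Sum>J<c * d. g J) = (\<Sum>j<c. \<Sum>s<d. g (j * d + s))"
proof -
  have "(\<Sum>s<d. g (j * d + s)) = sum g {j * d..<j * d + d}" for j
    using sum.shift_bounds_nat_ivl[of g 0 "j * d" d]
    by (simp add: lessThan_atLeast0 add.commute)
  then show ?thesis
    by (simp add: sum.nat_group)
qed

lemma block_index_less: "i < r \<Longrightarrow> t < d \<Longrightarrow> i * d + t < r * (d :: nat)"
  by (metis add.commute add_less_cancel_left mult_Suc mult_le_mono1 order_less_le_trans Suc_leI)

text \<open>
  The elements \<open>b 0, \<dots>, b (d - 1)\<close> of \<open>'f\<close> are a basis over the prime field, and \<open>T\<close> is a separating set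
  of functionals of \<open>'k\<close> with values in the prime field of \<open>'f\<close>. Replacing each entry \<open>a\<close> of a matrix
  by the matrix of the multiplication by \<open>a\<close> makes \<open>'k\<^sup>d\<close> a vector space over \<open>'f\<close>, for which the
  maps \<open>fold_vec \<tau>\<close> below are linear.
\<close>

locale field_change =
  fixes d :: nat and b :: "nat \<Rightarrow> 'f :: finite_field" and co :: "'f \<Rightarrow> nat \<Rightarrow> int"
    and T :: "('k :: finite_field \<Rightarrow> 'f) set"
  assumes d: "0 < d"
    and co: "x = (\<Sum>t<d. of_int (co x t) * b t)"
    and indep: "(\<Sum>t<d. of_int (m t) * b t) = 0 \<Longrightarrow> t < d \<Longrightarrow> of_int (m t) = (0 :: 'f)"
    and T_add: "\<tau> \<in> T \<Longrightarrow> \<tau> (y + y') = \<tau> y + \<tau> y'"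
    and T_scale: "\<tau> \<in> T \<Longrightarrow> \<tau> (of_int z * y) = of_int z * \<tau> y"
    and T_Ints: "\<tau> \<in> T \<Longrightarrow> \<tau> y \<in> \<int>"
    and T_separating: "(\<And>\<tau>. \<tau> \<in> T \<Longrightarrow> \<tau> y = 0) \<Longrightarrow> y = 0"
begin

text \<open>Tensor over the prime field and let a block with entries \<open>v t\<close> stand for
  the sum of the \<open>v t\<close> \<otimes> \<open>b t\<close> in \<open>'k\<close> \<otimes>
  \<open>'f\<close>. Then \<open>fold_vec \<tau>\<close> is \<tau> \<otimes> id on each
  block.\<close>

definition fold_vec :: "('k \<Rightarrow> 'f) \<Rightarrow> 'k vec \<Rightarrow> 'f vec" where
  "fold_vec \<tau> v = vec (dim_vec v div d) (\<lambda>i. \<Sum>t<d. \<tau> (v $ (i * d + t)) * b t)"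

text \<open>This is id \<otimes> \<open>A\<close> in the same picture: in the block of an entry
  \<open>a\<close>, column \<open>s\<close> holds the coordinates of \<open>a * b s\<close>.\<close>

definition blow_up :: "'f mat \<Rightarrow> 'k mat" where
  "blow_up A = mat (dim_row A * d) (dim_col A * d)
     (\<lambda>(i, j). of_int (co (A $$ (i div d, j div d) * b (j mod d)) (i mod d)))"

lemma dim_fold_vec [simp]: "dim_vec (fold_vec \<tau> v) = dim_vec v div d"
  by (simp add: fold_vec_def)

lemma dim_blow_up [simp]: "dim_row (blow_up A) = dim_row A * d" "dim_col (blow_up A) = dim_col A * d"
  by (simp_all add: blow_up_def)

lemma T_diff: "\<tau> \<in> T \<Longrightarrow> \<tau> (x - y) = \<tau> x - \<tau> y"
  using T_add[of \<tau> "x - y" y] by simp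

lemma T_zero: "\<tau> \<in> T \<Longrightarrow> \<tau> 0 = 0"
  using T_diff[of \<tau> 0 0] by simp

lemma T_sum: "\<tau> \<in> T \<Longrightarrow> \<tau> (sum g A) = (\<Sum>x\<in>A. \<tau> (g x))"
  by (induction A rule: infinite_finite_induct) (simp_all add: T_zero T_add)

text \<open>\<tau> \<otimes> id and id \<otimes> \<open>A\<close> commute. In coordinates, the
  integer entries of \<open>blow_up A\<close> pull out of \<tau> and recombine with \<open>b\<close>
  to the products \<open>A $$ (i, j) * b s\<close>.\<close>

lemma fold_vec_blow_up:
  assumes "\<tau> \<in> T" "dim_vec w = dim_col A * d"
  shows "fold_vec \<tau> (blow_up A *\<^sub>v w) = A *\<^sub>v fold_vec \<tau> w"
proof (rule eq_vecI)
  show "dim_vec (fold_vec \<tau> (blow_up A *\<^sub>v w)) = dim_vec (A *\<^sub>v fold_vec \<tau> w)"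
    using d by simp
next
  fix i assume "i < dim_vec (A *\<^sub>v fold_vec \<tau> w)"
  then have i: "i < dim_row A" by simp
  define \<phi> where "\<phi> t J = co (A $$ (i, J div d) * b (J mod d)) t" for t J
  have entry: "(blow_up A *\<^sub>v w) $ (i * d + t) = (\<Sum>J<dim_col A * d. of_int (\<phi> t J) * w $ J)"
    if "t < d" for t
    using that i assms(2) block_index_less[OF i that]
    by (auto simp: blow_up_def scalar_prod_def \<phi>_def lessThan_atLeast0 intro!: sum.cong)
  have "fold_vec \<tau> (blow_up A *\<^sub>v w) $ i =
      (\<Sum>t<d. \<tau> (\<Sum>J<dim_col A * d. of_int (\<phi> t J) * w $ J) * b t)"
    using i d by (simp add: fold_vec_def entry)
  also have "\<dots> = (\<Sum>t<d. \<Sum>J<dim_col A * d. \<tau> (w $ J) * (of_int (\<phi> t J) * b t))"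
    by (simp only: T_sum[OF assms(1)] T_scale[OF assms(1)] sum_distrib_right) (simp add: mult_ac)
  also have "\<dots> = (\<Sum>J<dim_col A * d. \<tau> (w $ J) * (\<Sum>t<d. of_int (\<phi> t J) * b t))"
    by (subst sum.swap) (simp add: sum_distrib_left)
  also have "\<dots> = (\<Sum>J<dim_col A * d. \<tau> (w $ J) * (A $$ (i, J div d) * b (J mod d)))"
    by (simp add: \<phi>_def flip: co)
  also have "\<dots> = (\<Sum>j<dim_col A. \<Sum>s<d. \<tau> (w $ (j * d + s)) * (A $$ (i, j) * b s))"
    unfolding sum_lessThan_mult by (intro sum.cong) auto
  also have "\<dots> = (\<Sum>j<dim_col A. A $$ (i, j) * (\<Sum>s<d. \<tau> (w $ (j * d + s)) * b s))"
    by (simp add: sum_distrib_left ac_simps)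
  also have "\<dots> = (A *\<^sub>v fold_vec \<tau> w) $ i"
    using i assms(2) d by (simp add: fold_vec_def scalar_prod_def lessThan_atLeast0)
  finally show "fold_vec \<tau> (blow_up A *\<^sub>v w) $ i = (A *\<^sub>v fold_vec \<tau> w) $ i" .
qed

lemma fold_vec_append:
  assumes "d dvd dim_vec v" "d dvd dim_vec w"
  shows "fold_vec \<tau> (v @\<^sub>v w) = fold_vec \<tau> v @\<^sub>v fold_vec \<tau> w"
proof -
  obtain p q where p: "dim_vec v = p * d" and q: "dim_vec w = q * d"
    using assms by (metis dvd_div_mult_self)
  have pq: "(p * d + q * d) div d = p + q"
    using d by (simp flip: add_mult_distrib)
  show ?thesis
  proof (rule eq_vecI)
    fix i assume "i < dim_vec (fold_vec \<tau> v @\<^sub>v fold_vec \<tau> w)"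
    then have i: "i < p + q"
      using d by (simp add: p q)
    show "fold_vec \<tau> (v @\<^sub>v w) $ i = (fold_vec \<tau> v @\<^sub>v fold_vec \<tau> w) $ i"
    proof (cases "i < p")
      case True
      have "i * d + t < p * d" "i * d + t < p * d + q * d" if "t < d" for t
        using block_index_less[OF True that] by simp_all
      then show ?thesis
        using True i d by (simp add: fold_vec_def p q pq)
    next
      case False
      then have il: "i - p < q" "i = p + (i - p)"
        using i by simp_all
      have "i * d + t < p * d + q * d" "\<not> i * d + t < p * d"
        "i * d + t - p * d = (i - p) * d + t" if "t < d" for t
      proof -
        have "i * d = p * d + (i - p) * d"
          using il(2) by (metis add_mult_distrib)
        then show "i * d + t < p * d + q * d" "\<not> i * d + t < p * d"
          "i * d + t - p * d = (i - p) * d + t"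
          using block_index_less[OF il(1) that] by simp_all
      qed
      then show ?thesis
        using False i il(1) d by (simp add: fold_vec_def p q pq)
    qed
  qed (use d p q pq in simp)
qed

lemma fold_concat_vecs:
  assumes "\<And>x. x \<in> set xs \<Longrightarrow> d dvd dim_vec x"
  shows "fold_vec \<tau> (concat_vecs xs) = concat_vecs (map (fold_vec \<tau>) xs)"
  using assms
proof (induction xs)
  case Nil
  then show ?case by (auto simp: concat_vecs_Nil intro!: eq_vecI)
next
  case (Cons x xs)
  have "d dvd dim_vec (concat_vecs ys)" if "\<forall>y\<in>set ys. d dvd dim_vec y" for ys :: "'k vec list"
    using that by (induction ys) (simp_all add: concat_vecs_Nil concat_vecs_Cons)
  then have "d dvd dim_vec (concat_vecs xs)"
    using Cons.prems by simp
  then show ?case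
    using Cons by (simp add: concat_vecs_Cons fold_vec_append)
qed

text \<open>Equal folds give a relation among the \<open>b s\<close> for each block, with
  coefficients in the prime field. Independence kills every coefficient, and then \<open>T\<close>
  separates the entries.\<close>

lemma fold_vec_separating:
  assumes "dim_vec v = p * d" "dim_vec w = p * d" "\<And>\<tau>. \<tau> \<in> T \<Longrightarrow> fold_vec \<tau> v = fold_vec \<tau> w"
  shows "v = w"
proof (rule eq_vecI)
  fix J assume J: "J < dim_vec w"
  define i t where "i = J div d" and "t = J mod d"
  have it: "J = i * d + t" "t < d" "i < p"
    using J d assms(2) by (auto simp: i_def t_def less_mult_imp_div_less)
  have "\<tau> (v $ J - w $ J) = 0" if \<tau>: "\<tau> \<in> T" for \<tau>
  proof -
    have "\<exists>z. \<tau> (v $ (i * d + s) - w $ (i * d + s)) = of_int z" for s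
      using T_Ints[OF \<tau>] by (auto elim!: Ints_cases)
    then obtain m where m: "\<tau> (v $ (i * d + s) - w $ (i * d + s)) = of_int (m s)" for s
      by metis
    have "fold_vec \<tau> v $ i = fold_vec \<tau> w $ i"
      using assms(3)[OF \<tau>] by simp
    then have "(\<Sum>s<d. \<tau> (v $ (i * d + s) - w $ (i * d + s)) * b s) = 0"
      using it(3) assms(1,2) d by (simp add: fold_vec_def T_diff[OF \<tau>] left_diff_distrib sum_subtractf)
    then show ?thesis
      using indep[of m t] it by (simp add: m)
  qed
  then show "v $ J = w $ J"
    using T_separating[of "v $ J - w $ J"] by simp
qed (use assms in simp)

section \<open>The code over the second field\<close>

definition blow_up_code :: "(nat \<Rightarrow> 'f mat) \<Rightarrow> (nat \<Rightarrow> nat \<Rightarrow> 'f mat) \<Rightarrow> 'f code \<Rightarrow> 'k code" where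
  "blow_up_code A B C = \<lparr>msg_dim = \<lambda>i. msg_dim C i * d, edge_dim = edge_dim C * d,
     edge_fun = \<lambda>e xs. blow_up (A e) *\<^sub>v concat_vecs xs,
     dec_fun = \<lambda>v i xs. blow_up (B v i) *\<^sub>v concat_vecs xs\<rparr>"

lemma input_dims_blow_up_code: "input_dims N (blow_up_code A B C) v = map (\<lambda>m. m * d) (input_dims N C v)"
  by (simp add: input_dims_def blow_up_code_def)

text \<open>Each fold of a run of the new code is a run of the old one, where decoding is correct;
  separation lifts this back. All dimensions grow by the factor \<open>d\<close>, so the rates stay
  the same.\<close>

lemma linearly_achievable_blow_up:
  assumes "network N" "linearly_achievable TYPE('f) N r"
  shows "linearly_achievable TYPE('k) N r"
proof -
  interpret network N by fact
  obtain C :: "'f code" where C: "is_solution N C" "is_linear N C" "rate_vector N C = r"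
    using assms(2) unfolding linearly_achievable_def by blast
  interpret linear_solution N C
    by unfold_locales fact+
  let ?in = "\<lambda>v. sum_list (input_dims N C v)"
  have "\<exists>A. \<forall>e\<in>arcs (net_graph N). A e \<in> carrier_mat (edge_dim C) (?in (tail (net_graph N) e)) \<and>
      (\<forall>xs\<in>input_space N C (tail (net_graph N) e). edge_fun C e xs = A e *\<^sub>v concat_vecs xs)"
    by (intro bchoice ballI) (metis edge_matrix)
  then obtain A where A: "\<And>e. e \<in> arcs (net_graph N) \<Longrightarrow>
      A e \<in> carrier_mat (edge_dim C) (?in (tail (net_graph N) e))"
    and edge: "\<And>e xs. e \<in> arcs (net_graph N) \<Longrightarrow> xs \<in> input_space N C (tail (net_graph N) e) \<Longrightarrow>
      edge_fun C e xs = A e *\<^sub>v concat_vecs xs"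
    by blast
  \<comment> \<open>The choice is made over pairs, since \<open>bchoice\<close> yields functions of
    one argument.\<close>
  have "\<exists>B. \<forall>vi\<in>Sigma (receivers N) (demands N).
      B vi \<in> carrier_mat (msg_dim C (snd vi)) (?in (fst vi)) \<and>
      (\<forall>xs\<in>input_space N C (fst vi). dec_fun C (fst vi) (snd vi) xs = B vi *\<^sub>v concat_vecs xs)"
  proof (intro bchoice ballI)
    fix vi assume "vi \<in> Sigma (receivers N) (demands N)"
    then have "fst vi \<in> receivers N" "snd vi \<in> demands N (fst vi)" by auto
    then show "\<exists>B. B \<in> carrier_mat (msg_dim C (snd vi)) (?in (fst vi)) \<and>
      (\<forall>xs\<in>input_space N C (fst vi). dec_fun C (fst vi) (snd vi) xs = B *\<^sub>v concat_vecs xs)"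
      by (metis decoding_matrix)
  qed
  then obtain B' where B': "\<forall>vi\<in>Sigma (receivers N) (demands N).
      B' vi \<in> carrier_mat (msg_dim C (snd vi)) (?in (fst vi)) \<and>
      (\<forall>xs\<in>input_space N C (fst vi). dec_fun C (fst vi) (snd vi) xs = B' vi *\<^sub>v concat_vecs xs)"
    by blast
  define B where "B v i = B' (v, i)" for v i
  have B: "B v i \<in> carrier_mat (msg_dim C i) (?in v)"
    and dec: "xs \<in> input_space N C v \<Longrightarrow> dec_fun C v i xs = B v i *\<^sub>v concat_vecs xs"
    if "v \<in> receivers N" "i \<in> demands N v" for v i xs
    using B' that by (force simp: B_def)+
  have rows: "e \<in> arcs (net_graph N) \<Longrightarrow> dim_row (A e) = edge_dim C"
    "v \<in> receivers N \<Longrightarrow> i \<in> demands N v \<Longrightarrow> dim_row (B v i) = msg_dim C i" for e v i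
    using A[of e] B[of v i] by auto
  define C' where "C' = blow_up_code A B C"
  have C'_simps: "msg_dim C' i = msg_dim C i * d" "edge_dim C' = edge_dim C * d"
    "edge_fun C' e xs = blow_up (A e) *\<^sub>v concat_vecs xs"
    "dec_fun C' v i xs = blow_up (B v i) *\<^sub>v concat_vecs xs" for v i e xs
    by (simp_all add: C'_def blow_up_code_def)
  have dims': "input_dims N C' v = map (\<lambda>m. m * d) (input_dims N C v)" for v
    by (simp add: C'_def input_dims_blow_up_code)
  have in': "sum_list (input_dims N C' v) = ?in v * d" for v
    unfolding dims' by (simp add: sum_list_mult_const)
  have linear': "is_linear N C'"
    unfolding is_linear_def linear_on_def Let_def in'
  proof (intro conjI ballI)
    fix e assume "e \<in> arcs (net_graph N)"
    then show "\<exists>M\<in>carrier_mat (edge_dim C') (?in (tail (net_graph N) e) * d).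
        \<forall>xs\<in>input_space N C' (tail (net_graph N) e). edge_fun C' e xs = M *\<^sub>v concat_vecs xs"
      using A[of e] by (intro bexI[of _ "blow_up (A e)"]) (auto simp: C'_simps intro!: carrier_matI)
  next
    fix v i assume "v \<in> receivers N" "i \<in> demands N v"
    then show "\<exists>M\<in>carrier_mat (msg_dim C' i) (?in v * d).
        \<forall>xs\<in>input_space N C' v. dec_fun C' v i xs = M *\<^sub>v concat_vecs xs"
      using B[of v i] by (intro bexI[of _ "blow_up (B v i)"]) (auto simp: C'_simps intro!: carrier_matI)
  qed
  have "2 \<le> card (UNIV :: 'k set)"
    using card_mono[of "UNIV :: 'k set" "{0, 1}"] by simp
  moreover have "1 \<le> edge_dim C'"
    using d C(1) by (simp add: C'_simps is_solution_def is_code_def)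
  ultimately have code': "is_code N C'"
    unfolding is_code_def by (auto simp: C'_simps rows intro!: carrier_vecI)
  have solution': "is_solution N C'"
    unfolding is_solution_def
  proof (intro conjI code' allI impI ballI)
    fix x y v i
    assume x: "\<forall>i<num_msgs N. x i \<in> carrier_vec (msg_dim C' i)" and y: "carries N C' x y"
      and v: "v \<in> receivers N" and i: "i \<in> demands N v"
    have dim_x: "dim_vec (x j) = msg_dim C j * d" if "j < num_msgs N" for j
      using x that by (auto simp: C'_simps)
    have y_eq: "y e = blow_up (A e) *\<^sub>v concat_vecs (inputs N x y (tail (net_graph N) e))"
      if "e \<in> arcs (net_graph N)" for e
      using y that by (simp add: carries_def C'_simps)
    have dim_y: "dim_vec (y e) = edge_dim C * d" if "e \<in> arcs (net_graph N)" for e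
      using A[OF that] by (simp add: y_eq[OF that])
    have dim_in: "map dim_vec (inputs N x y u) = map (\<lambda>m. m * d) (input_dims N C u)" for u
      by (auto simp: inputs_def input_dims_def set_msgs_at set_edges_into dim_x dim_y)
    have dim_concat: "dim_vec (concat_vecs (inputs N x y u)) = ?in u * d" for u
      unfolding dim_concat_vecs dim_in by (simp add: sum_list_mult_const)
    have fold_in: "fold_vec \<tau> (concat_vecs (inputs N x y u)) =
        concat_vecs (inputs N (fold_vec \<tau> \<circ> x) (fold_vec \<tau> \<circ> y) u)" for \<tau> u
    proof -
      have "fold_vec \<tau> (concat_vecs (inputs N x y u)) = concat_vecs (map (fold_vec \<tau>) (inputs N x y u))"
        by (rule fold_concat_vecs) (auto simp: inputs_def set_msgs_at set_edges_into dim_x dim_y)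
      then show ?thesis
        by (simp add: inputs_def)
    qed
    have messages: "messages (fold_vec \<tau> \<circ> x)" for \<tau>
      using d by (auto simp: dim_x intro!: carrier_vecI)
    have in_space: "inputs N (fold_vec \<tau> \<circ> x) (fold_vec \<tau> \<circ> y) u \<in> input_space N C u" for \<tau> u
      by (rule inputs_in_input_space[OF messages])
        (use d in \<open>auto simp: set_edges_into dim_y intro!: carrier_vecI\<close>)
    have carries: "carries N C (fold_vec \<tau> \<circ> x) (fold_vec \<tau> \<circ> y)" if \<tau>: "\<tau> \<in> T" for \<tau>
      unfolding carries_def
    proof
      fix e assume e: "e \<in> arcs (net_graph N)"
      let ?u = "tail (net_graph N) e"
      have "fold_vec \<tau> (y e) = A e *\<^sub>v fold_vec \<tau> (concat_vecs (inputs N x y ?u))"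
        using A[OF e] by (simp add: y_eq[OF e] fold_vec_blow_up[OF \<tau>] dim_concat)
      then show "(fold_vec \<tau> \<circ> y) e = edge_fun C e (inputs N (fold_vec \<tau> \<circ> x) (fold_vec \<tau> \<circ> y) ?u)"
        by (simp add: fold_in edge[OF e in_space])
    qed
    have i': "i < num_msgs N"
      using demands[OF v] i by auto
    show "dec_fun C' v i (inputs N x y v) = x i"
    proof (rule fold_vec_separating)
      show "dim_vec (dec_fun C' v i (inputs N x y v)) = msg_dim C i * d"
        using B[OF v i] by (simp add: C'_simps)
      show "dim_vec (x i) = msg_dim C i * d"
        using i' by (rule dim_x)
      fix \<tau> assume \<tau>: "\<tau> \<in> T"
      have "fold_vec \<tau> (dec_fun C' v i (inputs N x y v)) =
          B v i *\<^sub>v fold_vec \<tau> (concat_vecs (inputs N x y v))"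
        using B[OF v i] by (simp add: C'_simps fold_vec_blow_up[OF \<tau>] dim_concat)
      also have "\<dots> = dec_fun C v i (inputs N (fold_vec \<tau> \<circ> x) (fold_vec \<tau> \<circ> y) v)"
        by (simp add: fold_in dec[OF v i in_space])
      also have "\<dots> = (fold_vec \<tau> \<circ> x) i"
        using C(1) carries[OF \<tau>] v i messages unfolding is_solution_def by blast
      finally show "fold_vec \<tau> (dec_fun C' v i (inputs N x y v)) = fold_vec \<tau> (x i)"
        by simp
    qed
  qed
  have "rate_vector N C' = rate_vector N C"
    using d by (simp add: rate_vector_def C'_simps)
  with solution' linear' C(3) show ?thesis
    unfolding linearly_achievable_def by blast
qed

end

lemma linearly_achievable_same_CHAR:
  assumes "CHAR('f :: finite_field) = CHAR('k :: finite_field)" "network N"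
    "linearly_achievable TYPE('f) N r"
  shows "linearly_achievable TYPE('k) N r"
proof -
  obtain d b and co :: "'f \<Rightarrow> nat \<Rightarrow> int" where coords: "0 < d"
    "\<And>x. x = (\<Sum>t<d. of_int (co x t) * b t)"
    "\<And>m t. (\<Sum>t<d. of_int (m t) * b t) = 0 \<Longrightarrow> t < d \<Longrightarrow> of_int (m t) = (0 :: 'f)"
    using exists_prime_field_coordinates by metis
  obtain T :: "('k \<Rightarrow> 'f) set" where T:
    "\<And>\<tau> x y. \<tau> \<in> T \<Longrightarrow> \<tau> (x + y) = \<tau> x + \<tau> y"
    "\<And>\<tau> z x. \<tau> \<in> T \<Longrightarrow> \<tau> (of_int z * x) = of_int z * \<tau> x"
    "\<And>\<tau> x. \<tau> \<in> T \<Longrightarrow> \<tau> x \<in> \<int>"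
    "\<And>x. (\<And>\<tau>. \<tau> \<in> T \<Longrightarrow> \<tau> x = 0) \<Longrightarrow> x = 0"
    using exists_prime_field_functionals[OF assms(1)] by metis
  interpret field_change d b co T
    by unfold_locales (fact coords T)+
  show ?thesis
    using assms(2,3) by (rule linearly_achievable_blow_up)
qed


section \<open>The counting bound\<close>

lemma additive_diff_sum:
  fixes f :: "('a \<Rightarrow> 'b \<Rightarrow> 'f :: ab_group_add) \<Rightarrow> 'f"
  assumes add: "\<And>u v. f (\<lambda>j c. u j c + v j c) = f u + f v"
  shows "f (\<lambda>j c. u j c - v j c) = f u - f v"
    and "finite A \<Longrightarrow> f (\<lambda>j c. \<Sum>l\<in>A. z l j c) = (\<Sum>l\<in>A. f (z l))"
proof -
  show "f (\<lambda>j c. u j c - v j c) = f u - f v"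
    using add[of "\<lambda>j c. u j c - v j c" v] by simp
  have zero: "f (\<lambda>j c. 0) = 0"
    using add[of "\<lambda>j c. 0" "\<lambda>j c. 0"] by simp
  show "f (\<lambda>j c. \<Sum>l\<in>A. z l j c) = (\<Sum>l\<in>A. f (z l))" if "finite A"
    using that by (induction A) (simp_all add: zero add)
qed

text \<open>\<open>f i c u\<close> models coordinate \<open>c\<close> of what bottleneck
  \<open>i\<close> carries for the message coordinates \<open>u\<close>, with message dimension
  \<open>k\<close> and edge dimension \<open>n\<close>. In \<open>zero\<close>, the case
  \<open>i = M\<close> excludes no message, as bottleneck \<open>M\<close> depends on all of
  them.\<close>

locale transfer_maps =
  fixes M k n :: nat and f :: "nat \<Rightarrow> nat \<Rightarrow> (nat \<Rightarrow> nat \<Rightarrow> 'f :: finite_field) \<Rightarrow> 'f"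
  assumes M: "2 \<le> M" and char_dvd: "of_nat (M - 1) = (0 :: 'f)"
    and add: "f i c (\<lambda>j c. u j c + v j c) = f i c u + f i c v"
    and zero: "i \<le> M \<Longrightarrow> c < n \<Longrightarrow>
      (\<And>j c. j < M \<Longrightarrow> j \<noteq> i \<Longrightarrow> c < k \<Longrightarrow> u j c = 0) \<Longrightarrow> f i c u = 0"
    and decode: "i < M \<Longrightarrow> (\<And>c. c < n \<Longrightarrow> f i c u = 0) \<Longrightarrow> (\<And>c. c < n \<Longrightarrow> f M c u = 0) \<Longrightarrow>
      c < k \<Longrightarrow> u i c = 0"
    and decode_all: "(\<And>i c. i < M \<Longrightarrow> c < n \<Longrightarrow> f i c u = 0) \<Longrightarrow> i < M \<Longrightarrow> c < k \<Longrightarrow> u i c = 0"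
begin

lemmas diff = additive_diff_sum(1)[where f = "f i c" for i c, OF add]
lemmas fsum = additive_diff_sum(2)[where f = "f i c" for i c, OF add]

text \<open>
  A parameter \<open>w\<close> encodes a message tuple \<open>x\<close> (rows below \<open>M\<close>), vectors \<open>s\<^sub>i\<close> (row \<open>M + i\<close>) and a
  vector \<open>t\<close> (row \<open>2 * M\<close>). The tuple \<open>probe i w\<close> is \<open>x\<close> with \<open>s\<^sub>i\<close> added to message \<open>i\<close> and, for
  \<open>i = 0\<close> only, \<open>t\<close> added to message \<open>1\<close>.
\<close>

definition probe :: "nat \<Rightarrow> (nat \<times> nat \<Rightarrow> 'f) \<Rightarrow> nat \<Rightarrow> nat \<Rightarrow> 'f" where
  "probe i w j c = w (j, c) + (if j = i then w (M + i, c) else 0) +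
     (if i = 0 \<and> j = 1 then w (2 * M, c) else 0)"

text \<open>
  If all the probes are invisible to the edges, then \<open>s\<^sub>i = - x\<^sub>i\<close>, so the sum of the probes is
  \<open>(M - 1) x\<close> plus \<open>t\<close> at message \<open>1\<close>, and the first summand vanishes in the characteristic at hand.
\<close>

lemma probe_kernel:
  assumes "\<And>i c. i < M \<Longrightarrow> c < n \<Longrightarrow> f i c (probe i w) = 0"
    and "\<And>i c. i < M \<Longrightarrow> c < n \<Longrightarrow> f M c (probe i w) = 0"
    and "j < 2 * M + 1" "c < k"
  shows "w (j, c) = 0"
proof -
  have s: "w (M + i, c) = - w (i, c)" if "i < M" "c < k" for i c
  proof -
    have "probe i w i c = 0"
      by (rule decode[where u = "probe i w"]) (use assms(1,2) that in auto)
    then show ?thesis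
      by (cases "i = 0") (simp_all add: probe_def eq_neg_iff_add_eq_0 add.commute)
  qed
  have sum_probe: "(\<Sum>i<M. probe i w j c) = (if j = 1 then w (2 * M, c) else 0)"
    if "j < M" "c < k" for j c
  proof -
    have "(\<Sum>i<M. probe i w j c) =
        (\<Sum>i<M. w (j, c)) + (\<Sum>i<M. if j = i then w (M + i, c) else 0) +
        (\<Sum>i<M. if i = 0 then (if j = 1 then w (2 * M, c) else 0) else 0)"
      unfolding probe_def sum.distrib by (intro arg_cong2[where f = "(+)"] sum.cong) auto
    also have "\<dots> = of_nat M * w (j, c) + w (M + j, c) + (if j = 1 then w (2 * M, c) else 0)"
      using that M by (simp add: sum.delta sum.delta')
    also have "of_nat M * w (j, c) + w (M + j, c) = of_nat (M - 1) * w (j, c)"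
      using M s[OF that] by (simp add: of_nat_diff algebra_simps)
    finally show ?thesis
      using char_dvd by simp
  qed
  define t :: "nat \<Rightarrow> nat \<Rightarrow> 'f" where "t = (\<lambda>j c. if j = 1 then w (2 * M, c) else 0)"
  \<comment> \<open>On the message coordinates the sum of the probes agrees with \<open>t\<close>.
    Every probe is invisible to bottleneck \<open>M\<close>, hence so is \<open>t\<close>.\<close>
  have t_M: "f M c t = 0" if "c < n" for c
  proof -
    have "f M c (\<lambda>j c. (\<Sum>i<M. probe i w j c) - t j c) = 0"
      using that by (intro zero[OF less_imp_le] zero[OF order_refl]) (auto simp: sum_probe t_def)
    then have "f M c t = f M c (\<lambda>j c. \<Sum>i<M. probe i w j c)"
      by (simp add: diff)
    also have "\<dots> = 0"
      using assms(2) that by (simp add: fsum)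
    finally show ?thesis .
  qed
  \<comment> \<open>\<open>t\<close> is supported on message \<open>1\<close>, so bottleneck
    \<open>1\<close> misses it too, and message \<open>1\<close> is decoded from bottlenecks
    \<open>1\<close> and \<open>M\<close>.\<close>
  have "t 1 c = 0" if "c < k" for c
    by (rule decode[where u = t]) (use M t_M that in \<open>auto intro!: zero simp: t_def\<close>)
  then have t0: "w (2 * M, c) = 0" if "c < k" for c
    using that by (simp add: t_def)
  have x0: "w (j, c) = 0" if "j < M" "c < k" for j c
  proof (rule decode_all[where u = "\<lambda>j c. w (j, c)", OF _ that])
    fix i c assume ic: "i < M" "c < n"
    \<comment> \<open>Once the row of \<open>t\<close> is zero, \<open>probe i w\<close> differs
      from the message tuple only at message \<open>i\<close>, which bottleneck \<open>i\<close>
      cannot see.\<close>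
    have "f i c (\<lambda>j c. probe i w j c - w (j, c)) = 0"
      using ic by (intro zero[OF less_imp_le] zero[OF order_refl]) (auto simp: probe_def t0)
    then show "f i c (\<lambda>j c. w (j, c)) = 0"
      using assms(1) ic by (simp add: diff)
  qed
  consider "j < M" | i where "j = M + i" "i < M" | "j = 2 * M"
    using assms(3) by (metis le_add_diff_inverse less_Suc_eq linorder_not_less mult_2
        nat_add_left_cancel_less Suc_eq_plus1)
  then show ?thesis
    using x0 s t0 assms(4) by cases auto
qed

text \<open>The parameters have \<open>(2 * M + 1) * k\<close> scalars. Bottlenecks \<open>i\<close>
  and \<open>M\<close>, applied to \<open>probe i\<close> for each \<open>i < M\<close>, yield
  \<open>2 * M * n\<close> scalars, and by \<open>probe_kernel\<close> these determine the
  parameters.\<close>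

lemma rate_bound: "(2 * M + 1) * k \<le> 2 * M * n"
proof -
  define D where "D = {..<2 * M + 1} \<times> {..<k}"
  define R where "R = {..<2 * M} \<times> {..<n}"
  define g where "g w = (\<lambda>(l, c). if l < M then f l c (probe l w) else f M c (probe (l - M) w))"
    for w
  \<comment> \<open>Extensional functions represent the arrays indexed by \<open>D\<close> and
    \<open>R\<close>, which makes them countable by \<open>card_PiE\<close>.\<close>
  have "inj_on (\<lambda>w. restrict (g w) R) (D \<rightarrow>\<^sub>E UNIV)"
  proof (rule inj_onI)
    fix w w' assume w: "w \<in> D \<rightarrow>\<^sub>E UNIV" "w' \<in> D \<rightarrow>\<^sub>E UNIV" and "restrict (g w) R = restrict (g w') R"
    then have eq: "g w (l, c) = g w' (l, c)" if "l < 2 * M" "c < n" for l c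
      using that by (metis R_def SigmaI lessThan_iff restrict_apply')
    have probe_diff: "probe i (\<lambda>p. w p - w' p) = (\<lambda>j c. probe i w j c - probe i w' j c)" for i
      by (auto simp: probe_def fun_eq_iff)
    have 1: "f i c (probe i (\<lambda>p. w p - w' p)) = 0" if "i < M" "c < n" for i c
      using eq[of i c] that by (simp add: g_def probe_diff diff)
    have 2: "f M c (probe i (\<lambda>p. w p - w' p)) = 0" if "i < M" "c < n" for i c
      using eq[of "M + i" c] that by (simp add: g_def probe_diff diff)
    show "w = w'"
    proof (rule PiE_ext[OF w])
      fix p assume "p \<in> D"
      then show "w p = w' p"
        using probe_kernel[OF 1 2, of "fst p" "snd p"] by (auto simp: D_def)
    qed
  qed
  then have "card (D \<rightarrow>\<^sub>E (UNIV :: 'f set)) \<le> card (R \<rightarrow>\<^sub>E (UNIV :: 'f set))"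
    by (rule card_inj_on_le)
      (simp_all add: image_subset_iff restrict_PiE_iff R_def finite_PiE del: restrict_apply)
  then have "card (UNIV :: 'f set) ^ ((2 * M + 1) * k) \<le> card (UNIV :: 'f set) ^ (2 * M * n)"
    by (simp add: card_PiE D_def R_def)
  moreover have "1 < card (UNIV :: 'f set)"
    using card_mono[of "UNIV :: 'f set" "{0, 1}"] by simp
  ultimately show ?thesis
    by (metis power_increasing_iff)
qed

end


section \<open>Networks detecting the characteristic\<close>

text \<open>
  In \<open>char_net M\<close> message \<open>j < M\<close> originates at node \<open>j\<close>. For \<open>i \<le> M\<close> the node \<open>M + i\<close> sees all the
  messages except message \<open>i\<close> (all of them for \<open>i = M\<close>), and the arc from \<open>M + i\<close> to \<open>2 * M + 1 + i\<close> is
  the only way out. Receiver \<open>3 * M + 2 + l\<close> demands message \<open>l\<close> from the bottlenecks \<open>l\<close> and \<open>M\<close>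
  if \<open>l < M\<close>, and receiver \<open>4 * M + 2\<close> demands all the messages from the bottlenecks \<open>0, \<dots>, M - 1\<close>.
\<close>

definition char_arc :: "nat \<Rightarrow> nat \<Rightarrow> nat \<Rightarrow> bool" where
  "char_arc M a b \<longleftrightarrow>
     (\<exists>i\<le>M. a < M \<and> a \<noteq> i \<and> b = M + i) \<or>
     (\<exists>i\<le>M. a = M + i \<and> b = 2 * M + 1 + i) \<or>
     (\<exists>l<M. (a = 2 * M + 1 + l \<or> a = 3 * M + 1) \<and> b = 3 * M + 2 + l) \<or>
     (\<exists>i<M. a = 2 * M + 1 + i \<and> b = 4 * M + 2)"

definition char_net :: "nat \<Rightarrow> net" where
  "char_net M = \<lparr>net_graph = \<lparr>verts = {..4 * M + 2}, arcs = prod_encode ` {(a, b). char_arc M a b},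
       tail = fst \<circ> prod_decode, head = snd \<circ> prod_decode\<rparr>,
     sources = {..<M}, receivers = {3 * M + 2..4 * M + 2}, num_msgs = M, origin = id,
     demands = (\<lambda>v. if v = 4 * M + 2 then {..<M} else {v - (3 * M + 2)})\<rparr>"

section \<open>Layers and incoming arcs\<close>

lemma char_net_simps [simp]:
  "verts (net_graph (char_net M)) = {..4 * M + 2}"
  "prod_encode (a, b) \<in> arcs (net_graph (char_net M)) \<longleftrightarrow> char_arc M a b"
  "tail (net_graph (char_net M)) (prod_encode (a, b)) = a"
  "head (net_graph (char_net M)) (prod_encode (a, b)) = b"
  "sources (char_net M) = {..<M}" "receivers (char_net M) = {3 * M + 2..4 * M + 2}"
  "num_msgs (char_net M) = M" "origin (char_net M) i = i"
  "demands (char_net M) v = (if v = 4 * M + 2 then {..<M} else {v - (3 * M + 2)})"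
  by (auto simp: char_net_def inj_image_mem_iff[OF inj_prod_encode])

text \<open>No two arcs are parallel, so an arc can be named by the code of its pair of
  ends.\<close>

lemma char_arcE:
  assumes "e \<in> arcs (net_graph (char_net M))"
  obtains a b where "e = prod_encode (a, b)" "char_arc M a b"
  using assms by (auto simp: char_net_def)

lemma char_arc_bounds: "char_arc M a b \<Longrightarrow> a < b \<and> b \<le> 4 * M + 2"
  by (auto simp: char_arc_def)

text \<open>The layers \<open>j\<close>, \<open>M + i\<close>, \<open>2 * M + 1 + i\<close>,
  \<open>3 * M + 2 + l\<close> and \<open>4 * M + 2\<close>, with \<open>j, l < M\<close> and
  \<open>i \<le> M\<close>, are disjoint, so the head determines the kind of arc. Node
  \<open>3 * M + 1\<close> is the end of bottleneck \<open>M\<close>.\<close>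

lemma char_arc_into:
  "j < M \<Longrightarrow> \<not> char_arc M a j"
  "i \<le> M \<Longrightarrow> char_arc M a (M + i) \<longleftrightarrow> a < M \<and> a \<noteq> i"
  "i \<le> M \<Longrightarrow> char_arc M a (2 * M + 1 + i) \<longleftrightarrow> a = M + i"
  "l < M \<Longrightarrow> char_arc M a (3 * M + 2 + l) \<longleftrightarrow> a = 2 * M + 1 + l \<or> a = 3 * M + 1"
  "char_arc M a (4 * M + 2) \<longleftrightarrow> (\<exists>i<M. a = 2 * M + 1 + i)"
  by (auto simp: char_arc_def)

text \<open>Arcs lead from smaller to larger node numbers, which excludes cycles.\<close>

lemma network_char_net: "network (char_net M)"
proof
  have "prod_encode ` {(a, b). char_arc M a b} \<subseteq> prod_encode ` ({..4 * M + 2} \<times> {..4 * M + 2})"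
    using char_arc_bounds by (intro image_mono) fastforce
  then have "finite (prod_encode ` {(a, b). char_arc M a b})"
    by (rule finite_subset) simp
  then show "finite (arcs (net_graph (char_net M)))"
    by (simp add: char_net_def)
  have "arcs_ends (net_graph (char_net M)) \<subseteq> {(a, b). a < b}"
    using char_arc_bounds by (auto simp: arcs_ends_conv elim!: char_arcE)
  then show "acyclic (arcs_ends (net_graph (char_net M)))"
    by (rule acyclic_subset[OF wf_acyclic[OF wf_less]])
qed (auto elim!: char_arcE dest: char_arc_bounds split: if_splits)

lemma set_edges_into_char_net:
  "set (edges_into (char_net M) v) = (\<lambda>a. prod_encode (a, v)) ` {a. char_arc M a v}"
  using network.set_edges_into[OF network_char_net] by (auto elim!: char_arcE)

lemma distinct_edges_into: "distinct (edges_into N v)"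
  by (simp add: edges_into_def)

lemma sum_edges_into_char_net:
  "(\<Sum>e\<in>set (edges_into (char_net M) v). g e) = (\<Sum>a | char_arc M a v. g (prod_encode (a, v)))"
  unfolding set_edges_into_char_net by (subst sum.reindex) (auto intro: inj_onI)

lemma set_msgs_at_char_net: "set (msgs_at (char_net M) v) = {i. i < M \<and> i = v}"
  by (simp add: msgs_at_def)


subsection \<open>A code of rate one\<close>

lemma dim_concat_vecs_scalar:
  "\<forall>x\<in>set xs. dim_vec x = 1 \<Longrightarrow> dim_vec (concat_vecs xs) = length xs"
  by (induction xs) (simp_all add: concat_vecs_Nil concat_vecs_Cons)

lemma concat_vecs_scalar:
  assumes "\<forall>x\<in>set xs. dim_vec x = 1" "t < length xs"
  shows "concat_vecs xs $ t = xs ! t $ 0"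
  using assms
proof (induction xs arbitrary: t)
  case (Cons x xs)
  then show ?case
    by (cases t) (simp_all add: concat_vecs_Cons dim_concat_vecs_scalar)
qed simp

lemma linear_on_scalar:
  assumes "\<And>xs. xs \<in> X \<Longrightarrow> map dim_vec xs = replicate c 1"
    and "\<And>xs. xs \<in> X \<Longrightarrow> f xs = vec 1 (\<lambda>_. \<Sum>t<length xs. w t * xs ! t $ 0)"
  shows "linear_on X 1 c f"
  unfolding linear_on_def
proof (intro bexI ballI)
  fix xs assume xs: "xs \<in> X"
  have "length xs = c"
    using arg_cong[where f = length, OF assms(1)[OF xs]] by simp
  moreover have "\<forall>x\<in>set xs. dim_vec x = 1"
    using arg_cong[where f = set, OF assms(1)[OF xs]] by (auto split: if_splits)
  ultimately show "f xs = mat 1 c (\<lambda>(_, t). w t) *\<^sub>v concat_vecs xs"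
    unfolding assms(2)[OF xs]
    by (intro eq_vecI) (auto simp: scalar_prod_def dim_concat_vecs_scalar concat_vecs_scalar
        lessThan_atLeast0 intro!: sum.cong)
qed simp

text \<open>
  Every arc carries the sum of its inputs, so bottleneck \<open>i < M\<close> carries the sum of all the messages
  except message \<open>i\<close>. The sum over \<open>i < M\<close> of these is \<open>M - 1\<close> times the sum of all the messages.
\<close>

definition char_coeff :: "nat \<Rightarrow> nat \<Rightarrow> nat \<Rightarrow> nat \<Rightarrow> 'k :: finite_field" where
  "char_coeff M v i a = (if v = 4 * M + 2 then inverse (of_nat (M - 1)) - (if a = 2 * M + 1 + i then 1 else 0)
     else if a = 3 * M + 1 then 1 else - 1)"

definition sum_code :: "nat \<Rightarrow> 'k :: finite_field code" where
  "sum_code M = \<lparr>msg_dim = \<lambda>_. 1, edge_dim = 1,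
     edge_fun = \<lambda>e xs. vec 1 (\<lambda>_. \<Sum>t<length xs. xs ! t $ 0),
     dec_fun = \<lambda>v i xs. vec 1 (\<lambda>_. \<Sum>t<length xs.
       char_coeff M v i (fst (prod_decode (edges_into (char_net M) v ! t))) * xs ! t $ 0)\<rparr>"

lemma sum_code_simps [simp]: "msg_dim (sum_code M) i = 1" "edge_dim (sum_code M) = 1"
  by (simp_all add: sum_code_def)

lemma sum_lessThan_nth:
  fixes g :: "'b \<Rightarrow> 'a :: comm_monoid_add"
  shows "(\<Sum>t<length xs. g (xs ! t)) = sum_list (map g xs)"
  by (simp add: sum_list_sum_nth atLeast0LessThan)

lemma input_dims_sum_code:
  "input_dims N (sum_code M :: 'k :: finite_field code) v =
    replicate (sum_list (input_dims N (sum_code M :: 'k code) v)) 1"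
proof -
  have "input_dims N (sum_code M :: 'k code) v = replicate (length (msgs_at N v) + length (edges_into N v)) 1"
    by (simp add: input_dims_def sum_code_def map_replicate_const replicate_add)
  then show ?thesis
    by (simp add: sum_list_replicate)
qed

lemma is_linear_sum_code: "is_linear N (sum_code M :: 'k :: finite_field code)"
proof -
  have dims: "map dim_vec xs = replicate (sum_list (input_dims N (sum_code M :: 'k code) v)) 1"
    if "xs \<in> input_space N (sum_code M :: 'k code) v" for xs v
    using that input_dims_sum_code by (metis in_input_space_iff)
  show ?thesis
    unfolding is_linear_def Let_def sum_code_simps
  proof (intro conjI ballI)
    fix e assume "e \<in> arcs (net_graph N)"
    let ?v = "tail (net_graph N) e"
    show "linear_on (input_space N (sum_code M :: 'k code) ?v) 1
        (sum_list (input_dims N (sum_code M :: 'k code) ?v)) (edge_fun (sum_code M) e)"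
      by (rule linear_on_scalar[OF dims, where w = "\<lambda>_. 1"]) (simp_all add: sum_code_def)
  next
    fix v i assume "v \<in> receivers N" "i \<in> demands N v"
    show "linear_on (input_space N (sum_code M :: 'k code) v) 1
        (sum_list (input_dims N (sum_code M :: 'k code) v)) (dec_fun (sum_code M) v i)"
      by (rule linear_on_scalar[OF dims, where
            w = "\<lambda>t. char_coeff M v i (fst (prod_decode (edges_into (char_net M) v ! t)))"])
        (simp_all add: sum_code_def)
  qed
qed

lemma sum_code_edge_value:
  fixes x y :: "nat \<Rightarrow> 'k :: finite_field vec"
  assumes "carries (char_net M) (sum_code M) x y" "char_arc M a b"
  shows "y (prod_encode (a, b)) $ 0 =
    (\<Sum>i | i < M \<and> i = a. x i $ 0) + (\<Sum>c | char_arc M c a. y (prod_encode (c, a)) $ 0)"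
proof -
  have "y (prod_encode (a, b)) = edge_fun (sum_code M) (prod_encode (a, b)) (inputs (char_net M) x y a)"
    using assms by (auto simp: carries_def elim!: ballE)
  then have "y (prod_encode (a, b)) $ 0 = sum_list (map (\<lambda>v. v $ 0) (inputs (char_net M) x y a))"
    by (simp add: sum_code_def sum_lessThan_nth[where g = "\<lambda>v. v $ 0"])
  also have "\<dots> = sum_list (map (\<lambda>i. x i $ 0) (msgs_at (char_net M) a)) +
      sum_list (map (\<lambda>d. y d $ 0) (edges_into (char_net M) a))"
    by (simp add: inputs_def comp_def)
  also have "sum_list (map (\<lambda>i. x i $ 0) (msgs_at (char_net M) a)) = (\<Sum>i | i < M \<and> i = a. x i $ 0)"
    by (subst sum_list_distinct_conv_sum_set) (simp_all add: msgs_at_def)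
  also have "sum_list (map (\<lambda>d. y d $ 0) (edges_into (char_net M) a)) =
      (\<Sum>c | char_arc M c a. y (prod_encode (c, a)) $ 0)"
    by (subst sum_list_distinct_conv_sum_set) (simp_all add: sum_edges_into_char_net distinct_edges_into)
  finally show ?thesis .
qed

lemma is_solution_sum_code:
  assumes "of_nat (M - 1) \<noteq> (0 :: 'k :: finite_field)"
  shows "is_solution (char_net M) (sum_code M :: 'k code)"
  unfolding is_solution_def
proof (intro conjI allI impI ballI)
  have "2 \<le> card (UNIV :: 'k set)"
    using card_mono[of "UNIV :: 'k set" "{0, 1}"] by simp
  then show "is_code (char_net M) (sum_code M :: 'k code)"
    by (simp add: is_code_def) (simp add: sum_code_def)
next
  fix x y :: "nat \<Rightarrow> 'k vec" and v i
  assume x: "\<forall>i<num_msgs (char_net M). x i \<in> carrier_vec (msg_dim (sum_code M :: 'k code) i)"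
    and y: "carries (char_net M) (sum_code M) x y"
    and v: "v \<in> receivers (char_net M)" and i: "i \<in> demands (char_net M) v"
  note arc_value = sum_code_edge_value[OF y]
  define S where "S = (\<Sum>j<M. x j $ 0)"
  have source: "y (prod_encode (j, M + i)) $ 0 = x j $ 0" if "j < M" "i \<le> M" "j \<noteq> i" for i j
  proof -
    have "{i. i < M \<and> i = j} = {j}" using that by auto
    then show ?thesis
      using arc_value[of j "M + i"] that by (simp add: char_arc_into)
  qed
  have no_msg: "(\<Sum>j | j < M \<and> j = a. x j $ 0) = 0" if "M \<le> a" for a
    by (rule sum.neutral) (use that in auto)
  have bottleneck: "y (prod_encode (M + i, 2 * M + 1 + i)) $ 0 = S - (if i < M then x i $ 0 else 0)"
    if "i \<le> M" for i
  proof -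
    have "char_arc M (M + i) (2 * M + 1 + i)"
      using char_arc_into(3)[OF that] by blast
    moreover have "{j. char_arc M j (M + i)} = {..<M} - {i}"
      using char_arc_into(2)[OF that] by auto
    ultimately have "y (prod_encode (M + i, 2 * M + 1 + i)) $ 0 = (\<Sum>j\<in>{..<M} - {i}. x j $ 0)"
      using arc_value[of "M + i" "2 * M + 1 + i"] no_msg[of "M + i"] that source by simp
    then show ?thesis
      by (simp add: S_def sum_diff1)
  qed
  have relay: "y (prod_encode (2 * M + 1 + i, b)) $ 0 = S - (if i < M then x i $ 0 else 0)"
    if "i \<le> M" "char_arc M (2 * M + 1 + i) b" for i b
    using arc_value[OF that(2)] bottleneck[OF that(1)] char_arc_into(3)[OF that(1)]
      no_msg[of "2 * M + 1 + i"] by simp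
  have relay_M: "y (prod_encode (3 * M + 1, b)) $ 0 = S" if "char_arc M (3 * M + 1) b" for b
    using relay[of M b] that by simp
  \<comment> \<open>No message originates at a receiver, so its input number \<open>t\<close> comes
    from its incoming arc number \<open>t\<close>, whose tail selects the decoding weight.\<close>
  have "{i. i < M \<and> i = v} = {}"
    using v by auto
  then have no_msgs: "msgs_at (char_net M) v = []"
    by (simp only: set_msgs_at_char_net flip: set_empty)
  define c :: "nat \<Rightarrow> 'k" where "c = char_coeff M v i"
  have "dec_fun (sum_code M) v i (inputs (char_net M) x y v) =
      vec 1 (\<lambda>_. \<Sum>t<length (edges_into (char_net M) v).
        c (fst (prod_decode (edges_into (char_net M) v ! t))) * y (edges_into (char_net M) v ! t) $ 0)"
    by (auto simp: sum_code_def inputs_def no_msgs c_def intro!: sum.cong)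
  also have "\<dots> = vec 1 (\<lambda>_. \<Sum>a | char_arc M a v. c a * y (prod_encode (a, v)) $ 0)"
    unfolding sum_lessThan_nth[where g = "\<lambda>e. c (fst (prod_decode e)) * y e $ 0"]
    by (subst sum_list_distinct_conv_sum_set)
      (simp_all add: sum_edges_into_char_net distinct_edges_into)
  also have "(\<Sum>a | char_arc M a v. c a * y (prod_encode (a, v)) $ 0) = x i $ 0"
  proof (cases "v = 4 * M + 2")
    case True
    then have iM: "i < M" using i by simp
    have "(\<Sum>a | char_arc M a v. c a * y (prod_encode (a, v)) $ 0) =
        (\<Sum>l<M. c (2 * M + 1 + l) * y (prod_encode (2 * M + 1 + l, v)) $ 0)"
      unfolding True by (rule sum.reindex_cong[of "\<lambda>l. 2 * M + 1 + l"])
        (auto simp: char_arc_into(5)[simplified] intro: inj_onI)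
    \<comment> \<open>The uniform weight turns the total \<open>(M - 1) * S\<close> of the almost
      complete sums into \<open>S\<close>; the extra \<open>- 1\<close> at \<open>l = i\<close>
      subtracts \<open>S - x i\<close>.\<close>
    also have "\<dots> = (\<Sum>l<M. (inverse (of_nat (M - 1)) - (if l = i then 1 else 0)) * (S - x l $ 0))"
      using relay[where b = v] char_arc_into(5)[of M]
      by (intro sum.cong refl) (simp add: c_def char_coeff_def True)
    also have "\<dots> = inverse (of_nat (M - 1)) * (\<Sum>l<M. S - x l $ 0) -
        (\<Sum>l<M. if l = i then S - x l $ 0 else 0)"
      by (subst sum_distrib_left, subst sum_subtractf[symmetric], intro sum.cong refl)
        (simp add: left_diff_distrib)
    also have "(\<Sum>l<M. S - x l $ 0) = of_nat (M - 1) * S"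
      using iM by (simp add: sum_subtractf S_def[symmetric] of_nat_diff algebra_simps)
    also have "(\<Sum>l<M. if l = i then S - x l $ 0 else 0) = S - x i $ 0"
      using iM by (simp add: sum.delta)
    finally show ?thesis
      using assms by simp
  next
    case False
    then have iM: "i < M" "v = 3 * M + 2 + i" using v i by auto
    \<comment> \<open>The two inputs are \<open>S\<close> and \<open>S - x i\<close>, with weights
      \<open>1\<close> and \<open>- 1\<close>.\<close>
    then have "{a. char_arc M a v} = {2 * M + 1 + i, 3 * M + 1}"
      using char_arc_into(4)[of i M] by auto
    then show ?thesis
      using iM relay[of i v] relay_M[of v] char_arc_into(4)[of i M] False
      by (simp add: c_def char_coeff_def)
  qed
  also have "vec 1 (\<lambda>_. x i $ 0) = x i"
  proof -
    have "i < M" using v i by (auto split: if_splits)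
    then have "dim_vec (x i) = 1" using x by auto
    then show ?thesis by (intro eq_vecI) auto
  qed
  finally show "dec_fun (sum_code M) v i (inputs (char_net M) x y v) = x i" .
qed

lemma one_le_linear_capacity_char_net:
  assumes "of_nat (M - 1) \<noteq> (0 :: 'k :: finite_field)"
  shows "1 \<le> linear_capacity TYPE('k) (char_net M)"
proof -
  have "rate_vector (char_net M) (sum_code M :: 'k code) = vec (num_msgs (char_net M)) (\<lambda>_. 1)"
    by (simp add: rate_vector_def)
  then have "linearly_achievable TYPE('k) (char_net M) (vec (num_msgs (char_net M)) (\<lambda>_. 1))"
    unfolding linearly_achievable_def using is_solution_sum_code[OF assms] is_linear_sum_code by blast
  then have "ereal (of_rat 1) \<le> linear_capacity TYPE('k) (char_net M)"
    unfolding linear_capacity_def by (intro Sup_upper) blast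
  then show ?thesis
    by (simp add: one_ereal_def)
qed


subsection \<open>The capacity in a bad characteristic\<close>

text \<open>The topology supplies the assumptions of \<open>transfer_maps\<close>: bottleneck
  \<open>i\<close> misses message \<open>i\<close>, and each receiver sees only the bottlenecks
  leading to it.\<close>

lemma char_net_rate_bound:
  fixes C :: "'f :: finite_field code"
  assumes M: "2 \<le> M" "of_nat (M - 1) = (0 :: 'f)"
    and C: "is_solution (char_net M) C" "is_linear (char_net M) C"
    and k: "\<And>i. i < M \<Longrightarrow> msg_dim C i = k"
  shows "(2 * M + 1) * k \<le> 2 * M * edge_dim C"
proof -
  interpret network "char_net M" by (rule network_char_net)
  interpret linear_solution "char_net M" C
    by unfold_locales fact+
  define n where "n = edge_dim C"
  define e where "e i = prod_encode (M + i, 2 * M + 1 + i)" for i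
  \<comment> \<open>The default \<open>0\<close> outside the range makes additivity hold for all
    indices, as the locale asks.\<close>
  define f where "f i c u = (if i \<le> M \<and> c < n then edge_vecs u (e i) $ c else 0)" for i c u
  have e: "e i \<in> arcs (net_graph (char_net M))" if "i \<le> M" for i
    using that by (simp add: e_def char_arc_into(3)[of _ M, simplified])
  note edge_zero = edge_zero[OF messages_msg_vecs carries_edge_vecs]
  note demanded_zero = demanded_zero[OF messages_msg_vecs carries_edge_vecs]
  have e_zero: "edge_vecs u (e i) = 0\<^sub>v n" if "i \<le> M" "\<And>c. c < n \<Longrightarrow> f i c u = 0" for i u
    using that edge_vecs_in_carrier[OF e[OF that(1)], of u]
    by (intro eq_vecI) (auto simp: f_def n_def)
  \<comment> \<open>The end of bottleneck \<open>i\<close> has no other input, so a silent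
    bottleneck silences all arcs after it.\<close>
  have relay: "edge_vecs u (prod_encode (2 * M + 1 + i, b)) = 0\<^sub>v n"
    if "i \<le> M" "char_arc M (2 * M + 1 + i) b" "\<And>c. c < n \<Longrightarrow> f i c u = 0" for i b u
    unfolding n_def
  proof (rule edge_zero)
    fix d assume "d \<in> set (edges_into (char_net M)
      (tail (net_graph (char_net M)) (prod_encode (2 * M + 1 + i, b))))"
    then have "d = e i"
      using char_arc_into(3)[OF that(1)] by (auto simp: set_edges_into_char_net e_def)
    then show "edge_vecs u d = 0\<^sub>v (edge_dim C)"
      using e_zero[OF that(1,3)] by (simp add: n_def)
  qed (use that in \<open>auto simp: set_msgs_at_char_net\<close>)
  \<comment> \<open>Receiver \<open>3 * M + 2 + i\<close> yields \<open>decode\<close>, and receiver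
    \<open>4 * M + 2\<close> yields \<open>decode_all\<close>.\<close>
  interpret transfer_maps M k n f
  proof
    show "2 \<le> M" "of_nat (M - 1) = (0 :: 'f)" by fact+
  next
    fix i c and u v :: "nat \<Rightarrow> nat \<Rightarrow> 'f"
    show "f i c (\<lambda>j c. u j c + v j c) = f i c u + f i c v"
      using edge_vecs_in_carrier[OF e, of i v]
      by (auto simp: f_def edge_vecs_add[OF e] n_def)
  next
    fix i c and u :: "nat \<Rightarrow> nat \<Rightarrow> 'f"
    assume i: "i \<le> M" and c: "c < n" and u: "\<And>j c. j < M \<Longrightarrow> j \<noteq> i \<Longrightarrow> c < k \<Longrightarrow> u j c = 0"
    have source: "edge_vecs u (prod_encode (j, M + i)) = 0\<^sub>v (edge_dim C)" if "j < M" "j \<noteq> i" for j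
    proof (rule edge_zero)
      show "prod_encode (j, M + i) \<in> arcs (net_graph (char_net M))"
        using that i by (simp add: char_arc_into)
    qed (use that u k in \<open>auto simp: set_msgs_at_char_net set_edges_into_char_net char_arc_into
        msg_vecs_def intro!: eq_vecI\<close>)
    have "edge_vecs u (e i) = 0\<^sub>v (edge_dim C)"
      by (rule edge_zero[OF e[OF i]])
        (use i source in \<open>auto simp: e_def set_msgs_at_char_net set_edges_into_char_net char_arc_into\<close>)
    then show "f i c u = 0"
      using c by (simp add: f_def n_def)
  next
    fix i c and u :: "nat \<Rightarrow> nat \<Rightarrow> 'f"
    assume i: "i < M" and fi: "\<And>c. c < n \<Longrightarrow> f i c u = 0" and fM: "\<And>c. c < n \<Longrightarrow> f M c u = 0"
      and c: "c < k"
    have "msg_vecs u i = 0\<^sub>v (msg_dim C i)"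
    proof (rule demanded_zero)
      show "3 * M + 2 + i \<in> receivers (char_net M)" "i \<in> demands (char_net M) (3 * M + 2 + i)"
        using i by simp_all
      fix d assume "d \<in> set (edges_into (char_net M) (3 * M + 2 + i))"
      then consider "d = prod_encode (2 * M + 1 + i, 3 * M + 2 + i)"
        | "d = prod_encode (2 * M + 1 + M, 3 * M + 2 + i)"
        using char_arc_into(4)[OF i] by (auto simp: set_edges_into_char_net)
      then show "edge_vecs u d = 0\<^sub>v (edge_dim C)"
        using relay[of i "3 * M + 2 + i" u] relay[of M "3 * M + 2 + i" u] fi fM i
          char_arc_into(4)[OF i] by cases (simp_all add: n_def)
    qed (use i in \<open>auto simp: set_msgs_at_char_net\<close>)
    then have "msg_vecs u i $ c = 0"
      using c k[OF i] by simp
    then show "u i c = 0"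
      using c k[OF i] by (simp add: msg_vecs_def)
  next
    fix i c and u :: "nat \<Rightarrow> nat \<Rightarrow> 'f"
    assume f0: "\<And>i c. i < M \<Longrightarrow> c < n \<Longrightarrow> f i c u = 0" and i: "i < M" and c: "c < k"
    have "msg_vecs u i = 0\<^sub>v (msg_dim C i)"
    proof (rule demanded_zero)
      show "4 * M + 2 \<in> receivers (char_net M)" "i \<in> demands (char_net M) (4 * M + 2)"
        using i by simp_all
      fix d assume "d \<in> set (edges_into (char_net M) (4 * M + 2))"
      then obtain l where "l < M" "d = prod_encode (2 * M + 1 + l, 4 * M + 2)"
        using char_arc_into(5)[of M] by (auto simp: set_edges_into_char_net)
      then show "edge_vecs u d = 0\<^sub>v (edge_dim C)"
        using relay[of l "4 * M + 2" u] f0 char_arc_into(5)[of M "2 * M + 1 + l"] by (auto simp: n_def)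
    qed (auto simp: set_msgs_at_char_net)
    then have "msg_vecs u i $ c = 0"
      using c k[OF i] by simp
    then show "u i c = 0"
      using c k[OF i] by (simp add: msg_vecs_def)
  qed
  show ?thesis
    using rate_bound by (simp add: n_def)
qed

text \<open>The bound \<open>B\<close> is the same for all block sizes, so the supremum too stays
  below \<open>1\<close>.\<close>

lemma linear_capacity_char_net_less_one:
  assumes M: "2 \<le> M" "of_nat (M - 1) = (0 :: 'f :: finite_field)"
  shows "linear_capacity TYPE('f) (char_net M) < 1"
proof -
  define B :: rat where "B = of_nat (2 * M) / of_nat (2 * M + 1)"
  have "r \<le> B" if achievable: "linearly_achievable TYPE('f) (char_net M) (vec (num_msgs (char_net M)) (\<lambda>_. r))"
    for r
  proof -
    obtain C :: "'f code" where C: "is_solution (char_net M) C" "is_linear (char_net M) C"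
      "rate_vector (char_net M) C = vec M (\<lambda>_. r)"
      using achievable unfolding linearly_achievable_def by auto
    have n: "0 < edge_dim C"
      using C(1) by (simp add: is_solution_def is_code_def)
    have rate: "of_nat (msg_dim C i) = r * of_nat (edge_dim C)" if "i < M" for i
      using arg_cong[where f = "\<lambda>v. v $ i", OF C(3)] that n by (simp add: rate_vector_def field_simps)
    \<comment> \<open>Equal rates over one edge dimension force equal message dimensions, so a
      single \<open>k\<close> serves.\<close>
    have "msg_dim C i = msg_dim C 0" if "i < M" for i
      using rate[OF that] rate[of 0] M(1) by (metis of_nat_eq_iff gr_zeroI not_less_zero that)
    then have "(2 * M + 1) * msg_dim C 0 \<le> 2 * M * edge_dim C"
      by (rule char_net_rate_bound[OF M C(1,2)])
    then have "of_nat ((2 * M + 1) * msg_dim C 0) \<le> (of_nat (2 * M * edge_dim C) :: rat)"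
      by (simp only: of_nat_le_iff)
    then have "of_nat (2 * M + 1) * r * of_nat (edge_dim C) \<le> of_nat (2 * M) * of_nat (edge_dim C)"
      using rate[of 0] M(1) by (simp only: of_nat_mult mult.assoc)
    then have "of_nat (2 * M + 1) * r \<le> of_nat (2 * M)"
      using n by (simp only: mult_le_cancel_right_pos of_nat_0_less_iff)
    then show ?thesis
      unfolding B_def by (subst pos_le_divide_eq) (simp_all add: mult.commute)
  qed
  then have "linear_capacity TYPE('f) (char_net M) \<le> ereal (of_rat B)"
    unfolding linear_capacity_def by (intro Sup_least) (auto simp: of_rat_less_eq)
  also have "B < 1"
    by (simp add: B_def)
  then have "ereal (of_rat B) < 1"
    by (simp add: one_ereal_def)
  finally show ?thesis .
qed


section \<open>Capacities and the characteristic\<close>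

theorem corollary3p5:
  shows "CHAR('f :: finite_field) = CHAR('k :: finite_field) \<longleftrightarrow>
    (\<forall>N. network N \<longrightarrow> linear_capacity TYPE('f) N = linear_capacity TYPE('k) N)"
proof
  assume char: "CHAR('f) = CHAR('k)"
  have "linearly_achievable TYPE('f) N r \<longleftrightarrow> linearly_achievable TYPE('k) N r" if "network N" for N r
    using linearly_achievable_same_CHAR[OF char that] linearly_achievable_same_CHAR[OF char[symmetric] that]
    by blast
  then show "\<forall>N. network N \<longrightarrow> linear_capacity TYPE('f) N = linear_capacity TYPE('k) N"
    by (simp add: linear_capacity_def)
next
  assume capacities: "\<forall>N. network N \<longrightarrow> linear_capacity TYPE('f) N = linear_capacity TYPE('k) N"
  show "CHAR('f) = CHAR('k)"
  proof (rule ccontr)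
    assume "CHAR('f) \<noteq> CHAR('k)"
    then have "\<not> CHAR('k) dvd CHAR('f)"
      using primes_dvd_imp_eq[of "CHAR('k)" "CHAR('f)"] by auto
    \<comment> \<open>For \<open>M = CHAR('f) + 1\<close> the number \<open>M - 1\<close> vanishes
      in \<open>'f\<close>, but it is a prime other than \<open>CHAR('k)\<close> and hence
      invertible in \<open>'k\<close>.\<close>
    then have "of_nat (CHAR('f) + 1 - 1) \<noteq> (0 :: 'k)"
      by (simp add: of_nat_eq_0_iff_char_dvd)
    then have "1 \<le> linear_capacity TYPE('k) (char_net (CHAR('f) + 1))"
      by (rule one_le_linear_capacity_char_net)
    moreover have "linear_capacity TYPE('f) (char_net (CHAR('f) + 1)) < 1"
      by (rule linear_capacity_char_net_less_one) (simp_all add: Suc_leI)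
    ultimately show False
      using capacities network_char_net by auto
  qed
qed

end
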